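(* Let $N\ge1$, $d\ge1$. For all $\mathbf{s}\in\mathbb{N}^d$ and $\boldsymbol\eta\in(\Gamma_N)^d$, both symmetrized colored multiple zeta values $\zeta_\ast^{\mathcal{S}}\binom{\mathbf{s}}{\boldsymbol\eta}$ and $\zeta_{\sqcup\!\sqcup}^{\mathcal{S}}\binom{\mathbf{s}}{\boldsymbol\eta}$, which are a priori elements of $\mathbb{C}[T]$, are constant complex values, i.e. they are independent of $T$.
   Context: $\mathbb{N}$ denotes the positive integers, $\Gamma_N\subset\mathbb{C}$ the group of $N$th roots of unity. Colored multiple zeta values: $\zeta\binom{\mathbf{s}}{\boldsymbol\eta}:=\sum_{k_1>\cdots>k_d>0}\frac{\eta_1^{k_1}\cdots\eta_d^{k_d}}{k_1^{s_1}\cdots k_d^{s_d}}$ for $(s_1,\eta_1)\ne(1,1)$ (limit of the partial sums over $k_1\le n$). Words: $\mathfrak{A}_N=\mathbb{Q}\langle x_\eta:\eta\in\Gamma_N\cup\{0\}\rangle$; $\mathfrak{A}_N^1$ is the span of words not ending in $x_0$, freely generated by $y_{m,\mu}:=x_0^{m-1}x_\mu$ ($m\in\mathbb{N},\mu\in\Gamma_N$); $\mathfrak{A}_N^0\subset\mathfrak{A}_N^1$ is the span of words that moreover do not begin with $x_1$; $1$ is the empty word. The stuffle product $\ast$ on $\mathfrak{A}_N^1$: $1\ast w=w\ast1=w$, $y_{m,\mu}u\ast y_{n,\nu}v=y_{m,\mu}(u\ast y_{n,\nu}v)+y_{n,\nu}(y_{m,\mu}u\ast v)+y_{m+n,\mu\nu}(u\ast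 v)$. The shuffle product $\sqcup\!\sqcup$ on $\mathfrak{A}_N$: $1\sqcup\!\sqcup w=w\sqcup\!\sqcup1=w$, $au\sqcup\!\sqcup bv=a(u\sqcup\!\sqcup bv)+b(au\sqcup\!\sqcup v)$ for letters $a,b$. Regularization (known facts): the $\mathbb{Q}$-linear maps on $\mathfrak{A}_N^0$ given by $y_{s_1,\eta_1}\cdots y_{s_d,\eta_d}\mapsto\zeta\binom{s_1,\dots,s_d}{\eta_1,\dots,\eta_d}$ and $y_{s_1,\eta_1}\cdots y_{s_d,\eta_d}\mapsto\zeta\binom{s_1,\,s_2,\dots,\,s_d}{\eta_1,\,\eta_2/\eta_1,\dots,\,\eta_d/\eta_{d-1}}$ (and $1\mapsto1$) are algebra homomorphisms $(\mathfrak{A}_N^0,\ast)\to\mathbb{C}$ and $(\mathfrak{A}_N^0,\sqcup\!\sqcup)\to\mathbb{C}$ respectively, and they extend uniquely to algebra homomorphisms $\zeta_\ast(-;T)\colon(\mathfrak{A}_N^1,\ast)\to\mathbb{C}[T]$ with $\zeta_\ast(y_{1,1};T)=T$ and $\zeta_{\sqcup\!\sqcup}(-;T)\colon(\mathfrak{A}_N^1,\sqcup\!\sqcup)\to\mathbb{C}[T]$ with $\zeta_{\sqcup\!\sqcup}(x_1;T)=T$. For arbitrary $\mathbf{s},\boldsymbol\eta$ put $\zeta_\ast\big(\begin{smallmatrix}\mathbf{s}\\ \boldsymbol\eta\end{smallmatrix}\big|T\big):=\zeta_\ast(y_{s_1,\eta_1}\cdots y_{s_d,\eta_d};T)$ and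 $\zeta_{\sqcup\!\sqcup}\big(\begin{smallmatrix}\mathbf{s}\\ \boldsymbol\eta\end{smallmatrix}\big|T\big):=\zeta_{\sqcup\!\sqcup}(y_{s_1,\eta_1}y_{s_2,\eta_1\eta_2}\cdots y_{s_d,\eta_1\cdots\eta_d};T)$ (value $1$ for $d=0$). Symmetrized colored multiple zeta values: for $\sharp\in\{\ast,\sqcup\!\sqcup\}$, $$\zeta_\sharp^{\mathcal{S}}\binom{\mathbf{s}}{\boldsymbol\eta}:=\sum_{j=0}^d(-1)^{s_1+\cdots+s_j}\,\overline{\eta_1}\cdots\overline{\eta_j}\;\zeta_\sharp\Big(\begin{smallmatrix}s_j,\dots,s_1\\ \overline{\eta_j},\dots,\overline{\eta_1}\end{smallmatrix}\Big|T\Big)\,\zeta_\sharp\Big(\begin{smallmatrix}s_{j+1},\dots,s_d\\ \eta_{j+1},\dots,\eta_d\end{smallmatrix}\Big|T\Big).$$ *)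

theory Defs
  imports
    "HOL-Analysis.Analysis"
    "HOL-Library.Poly_Mapping"
    "HOL-Library.FuncSet"
    "HOL-Computational_Algebra.Polynomial"
begin

definition roots_of_unity :: "nat \<Rightarrow> complex set" where
  "roots_of_unity N = {z. z ^ N = 1}"

subsection \<open>Colored multiple zeta values\<close>

text \<open>An index is the list of the pairs \<open>(s\<^sub>i, \<eta>\<^sub>i)\<close>.\<close>

type_synonym index = "(nat \<times> complex) list"

definition cmzv_upto :: "index \<Rightarrow> nat \<Rightarrow> complex" where
  "cmzv_upto w n =
     (\<Sum>ks \<in> {ks. length ks = length w \<and> sorted_wrt (>) ks \<and> set ks \<subseteq> {1..n}}.
        \<Prod>i<length w. snd (w ! i) ^ (ks ! i) / of_nat (ks ! i) ^ fst (w ! i))"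

definition cmzv :: "index \<Rightarrow> complex" where
  "cmzv w = lim (cmzv_upto w)"

subsection \<open>Free algebras over the rationals\<close>

text \<open>The free algebra on an alphabet of type \<open>'a\<close> is the space \<open>'a list \<Rightarrow>\<^sub>0 rat\<close> of
  finitely supported functions on words.\<close>

abbreviation word :: "'a list \<Rightarrow> ('a list \<Rightarrow>\<^sub>0 rat)" where
  "word w \<equiv> Poly_Mapping.single w 1"

definition scale :: "rat \<Rightarrow> ('b \<Rightarrow>\<^sub>0 rat) \<Rightarrow> ('b \<Rightarrow>\<^sub>0 rat)" where
  "scale c p = Poly_Mapping.map ((*) c) p"

definition prepend :: "'a \<Rightarrow> ('a list \<Rightarrow>\<^sub>0 rat) \<Rightarrow> ('a list \<Rightarrow>\<^sub>0 rat)" where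
  "prepend a p = (\<Sum>w\<in>Poly_Mapping.keys p. Poly_Mapping.single (a # w) (Poly_Mapping.lookup p w))"

definition bilinear_ext ::
    "('a list \<Rightarrow> 'a list \<Rightarrow> ('a list \<Rightarrow>\<^sub>0 rat)) \<Rightarrow>
     ('a list \<Rightarrow>\<^sub>0 rat) \<Rightarrow> ('a list \<Rightarrow>\<^sub>0 rat) \<Rightarrow> ('a list \<Rightarrow>\<^sub>0 rat)" where
  "bilinear_ext f p q =
     (\<Sum>u\<in>Poly_Mapping.keys p. \<Sum>v\<in>Poly_Mapping.keys q.
        scale (Poly_Mapping.lookup p u * Poly_Mapping.lookup q v) (f u v))"

definition span_words :: "'a list set \<Rightarrow> ('a list \<Rightarrow>\<^sub>0 rat) set" where
  "span_words W = {p. Poly_Mapping.keys p \<subseteq> W}"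

text \<open>A homomorphism of unital algebras over the rationals to \<open>\<complex>[T]\<close>, from the subspace \<open>A\<close>
  with the product \<open>mul\<close> and with the empty word as unit. The variable \<open>T\<close> is \<open>[:0, 1:]\<close>.\<close>

definition algebra_hom ::
    "('a list \<Rightarrow>\<^sub>0 rat) set \<Rightarrow>
     (('a list \<Rightarrow>\<^sub>0 rat) \<Rightarrow> ('a list \<Rightarrow>\<^sub>0 rat) \<Rightarrow> ('a list \<Rightarrow>\<^sub>0 rat)) \<Rightarrow>
     (('a list \<Rightarrow>\<^sub>0 rat) \<Rightarrow> complex poly) \<Rightarrow> bool" where
  "algebra_hom A mul Z \<longleftrightarrow>
     Z (word []) = 1 \<and>
     (\<forall>p\<in>A. \<forall>q\<in>A. Z (p + q) = Z p + Z q) \<and>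
     (\<forall>c. \<forall>p\<in>A. Z (scale c p) = smult (of_rat c) (Z p)) \<and>
     (\<forall>p\<in>A. \<forall>q\<in>A. Z (mul p q) = Z p * Z q)"

subsection \<open>Words\<close>

text \<open>The letter \<open>x\<^sub>\<eta>\<close> is represented by the complex number \<open>\<eta>\<close>, and the letter
  \<open>y\<^bsub>m,\<mu>\<^esub> = x\<^sub>0\<^bsup>m-1\<^esup> x\<^sub>\<mu>\<close> by the pair \<open>(m, \<mu>)\<close>. The algebra of words not ending
  in \<open>x\<^sub>0\<close> occurs in both its bases: in \<open>A1_x\<close> its elements are combinations of words in
  the letters \<open>x\<^sub>\<eta>\<close>, in \<open>A1_y\<close> they are combinations of words in the free generators
  \<open>y\<^bsub>m,\<mu>\<^esub>\<close>. The map \<open>x_word\<close> rewrites a basis element from the latter to the former.\<close>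

definition x_word :: "index \<Rightarrow> complex list" where
  "x_word w = concat (map (\<lambda>(m, \<mu>). replicate (m - 1) 0 @ [\<mu>]) w)"

definition y_words :: "nat \<Rightarrow> index set" where
  "y_words N = lists ({m. 1 \<le> m} \<times> roots_of_unity N)"

definition A1_y :: "nat \<Rightarrow> (index \<Rightarrow>\<^sub>0 rat) set" where
  "A1_y N = span_words (y_words N)"

definition A1_x :: "nat \<Rightarrow> (complex list \<Rightarrow>\<^sub>0 rat) set" where
  "A1_x N = span_words {w \<in> lists (roots_of_unity N \<union> {0}). w = [] \<or> last w \<noteq> 0}"

text \<open>The words in the letters \<open>y\<^bsub>m,\<mu>\<^esub>\<close> that do not begin with \<open>x\<^sub>1\<close>; they are a
  basis of the algebra of convergent words.\<close>

definition y_words0 :: "nat \<Rightarrow> index set" where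
  "y_words0 N = {w \<in> y_words N. x_word w = [] \<or> hd (x_word w) \<noteq> 1}"

subsection \<open>Stuffle and shuffle product\<close>

fun stuffle_words :: "index \<Rightarrow> index \<Rightarrow> (index \<Rightarrow>\<^sub>0 rat)" where
  "stuffle_words [] w = word w"
| "stuffle_words w [] = word w"
| "stuffle_words ((m, \<mu>) # u) ((n, \<nu>) # v) =
     prepend (m, \<mu>) (stuffle_words u ((n, \<nu>) # v)) +
     prepend (n, \<nu>) (stuffle_words ((m, \<mu>) # u) v) +
     prepend (m + n, \<mu> * \<nu>) (stuffle_words u v)"

fun shuffle_words :: "'a list \<Rightarrow> 'a list \<Rightarrow> ('a list \<Rightarrow>\<^sub>0 rat)" where
  "shuffle_words [] w = word w"
| "shuffle_words w [] = word w"
| "shuffle_words (a # u) (b # v) =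
     prepend a (shuffle_words u (b # v)) + prepend b (shuffle_words (a # u) v)"

definition stuffle :: "(index \<Rightarrow>\<^sub>0 rat) \<Rightarrow> (index \<Rightarrow>\<^sub>0 rat) \<Rightarrow> (index \<Rightarrow>\<^sub>0 rat)" where
  "stuffle = bilinear_ext stuffle_words"

definition shuffle :: "('a list \<Rightarrow>\<^sub>0 rat) \<Rightarrow> ('a list \<Rightarrow>\<^sub>0 rat) \<Rightarrow> ('a list \<Rightarrow>\<^sub>0 rat)" where
  "shuffle = bilinear_ext shuffle_words"

subsection \<open>Regularization\<close>

text \<open>\<open>(s\<^sub>1, \<eta>\<^sub>1), (s\<^sub>2, \<eta>\<^sub>2), \<dots>\<close> is sent to
  \<open>(s\<^sub>1, \<eta>\<^sub>1), (s\<^sub>2, \<eta>\<^sub>2 / \<eta>\<^sub>1), (s\<^sub>3, \<eta>\<^sub>3 / \<eta>\<^sub>2), \<dots>\<close> by \<open>color_quotients\<close>, and to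
  \<open>(s\<^sub>1, \<eta>\<^sub>1), (s\<^sub>2, \<eta>\<^sub>1 \<eta>\<^sub>2), (s\<^sub>3, \<eta>\<^sub>1 \<eta>\<^sub>2 \<eta>\<^sub>3), \<dots>\<close> by \<open>color_products\<close>.\<close>

definition color_quotients :: "index \<Rightarrow> index" where
  "color_quotients w =
     map (\<lambda>i. (fst (w ! i), if i = 0 then snd (w ! i) else snd (w ! i) / snd (w ! (i - 1))))
       [0..<length w]"

definition color_products :: "index \<Rightarrow> index" where
  "color_products w = map (\<lambda>i. (fst (w ! i), \<Prod>j\<le>i. snd (w ! j))) [0..<length w]"

text \<open>The unique extensions to algebra homomorphisms on all words not ending in \<open>x\<^sub>0\<close>. Being
  \<open>extensional\<close> only fixes the irrelevant values outside of their domain.\<close>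

definition zeta_stuffle_hom :: "nat \<Rightarrow> (index \<Rightarrow>\<^sub>0 rat) \<Rightarrow> complex poly" where
  "zeta_stuffle_hom N = (THE Z. Z \<in> extensional (A1_y N) \<and>
     algebra_hom (A1_y N) stuffle Z \<and>
     (\<forall>w\<in>y_words0 N. Z (word w) = [:cmzv w:]) \<and>
     Z (word [(1, 1)]) = [:0, 1:])"

definition zeta_shuffle_hom :: "nat \<Rightarrow> (complex list \<Rightarrow>\<^sub>0 rat) \<Rightarrow> complex poly" where
  "zeta_shuffle_hom N = (THE Z. Z \<in> extensional (A1_x N) \<and>
     algebra_hom (A1_x N) shuffle Z \<and>
     (\<forall>w\<in>y_words0 N. Z (word (x_word w)) = [:cmzv (color_quotients w):]) \<and>
     Z (word [1]) = [:0, 1:])"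

definition zeta_stuffle :: "nat \<Rightarrow> nat list \<Rightarrow> complex list \<Rightarrow> complex poly" where
  "zeta_stuffle N s \<eta> = zeta_stuffle_hom N (word (zip s \<eta>))"

definition zeta_shuffle :: "nat \<Rightarrow> nat list \<Rightarrow> complex list \<Rightarrow> complex poly" where
  "zeta_shuffle N s \<eta> = zeta_shuffle_hom N (word (x_word (color_products (zip s \<eta>))))"

subsection \<open>Symmetrized colored multiple zeta values\<close>

definition symmetrized ::
    "(nat list \<Rightarrow> complex list \<Rightarrow> complex poly) \<Rightarrow> nat list \<Rightarrow> complex list \<Rightarrow> complex poly" where
  "symmetrized Z s \<eta> =
     (\<Sum>j = 0..length s.
        smult ((- 1) ^ sum_list (take j s) * prod_list (map cnj (take j \<eta>)))
          (Z (rev (take j s)) (rev (map cnj (take j \<eta>))) * Z (drop j s) (drop j \<eta>)))"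

definition zeta_stuffle_sym :: "nat \<Rightarrow> nat list \<Rightarrow> complex list \<Rightarrow> complex poly" where
  "zeta_stuffle_sym N = symmetrized (zeta_stuffle N)"

definition zeta_shuffle_sym :: "nat \<Rightarrow> nat list \<Rightarrow> complex list \<Rightarrow> complex poly" where
  "zeta_shuffle_sym N = symmetrized (zeta_shuffle N)"

end

theory Submission
  imports Defs "HOL-Computational_Algebra.Fundamental_Theorem_Algebra"
begin

text \<open>Truncated sums multiply by the stuffle product, and polylogarithms at a point of the unit
  interval multiply by the shuffle product. Let the truncation tend to infinity, respectively the
  point to \<open>1\<close>, and let \<open>L\<close> be the value at the letter \<open>y\<^bsub>1,1\<^esub> = x\<^sub>1\<close>, which diverges
  logarithmically. On a convergent word the distance to the colored multiple zeta value is smaller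
  than any negative power of \<open>L\<close>. As all words are generated by this letter over the convergent
  ones, the value at any word is up to such an error a polynomial in \<open>L\<close>, and these polynomials
  are the regularized values. Differentiation in \<open>T\<close> deletes a leading letter \<open>y\<^bsub>1,1\<^esub>\<close>, which
  makes the derivative of a symmetrized value a telescoping sum.\<close>

subsection \<open>Linear extension of functions on words\<close>

text \<open>The regularized values are definite descriptions, so nothing is known about them until
  existence and uniqueness of the homomorphisms are proved. Plain convergence on the convergent
  words is too weak for existence: in a product an error gets multiplied by a polynomial in the
  unbounded \<open>L\<close>, so it must beat every power of \<open>L\<close>. This forces explicit
  rates of convergence, of order \<open>1 / sqrt n\<close> up to logarithms. Both cases run through
  one locale, because along the points \<open>1 - 1 / (M + 1)\<close> the polylogarithm of the
  letter 1 is \<open>ln (M + 1)\<close>, which grows like the harmonic sum of the stuffle case. What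
  remains different is the merged letter of the stuffle product; it has weight at least 2 whenever
  \<open>(1, 1)\<close> is a factor, so it is invisible to the deletion of a leading
  \<open>(1, 1)\<close>.\<close>

definition linear_ext :: "('b \<Rightarrow> complex) \<Rightarrow> ('b \<Rightarrow>\<^sub>0 rat) \<Rightarrow> complex" where
  "linear_ext f p = (\<Sum>w\<in>Poly_Mapping.keys p. of_rat (Poly_Mapping.lookup p w) * f w)"

lemma linear_ext_superset:
  assumes "finite S" "Poly_Mapping.keys p \<subseteq> S"
  shows "linear_ext f p = (\<Sum>w\<in>S. of_rat (Poly_Mapping.lookup p w) * f w)"
  unfolding linear_ext_def using assms
  by (intro sum.mono_neutral_left) (auto simp: in_keys_iff)

lemma linear_ext_zero [simp]: "linear_ext f 0 = 0"
  by (simp add: linear_ext_def)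

lemma linear_ext_add: "linear_ext f (p + q) = linear_ext f p + linear_ext f q"
proof -
  let ?S = "Poly_Mapping.keys p \<union> Poly_Mapping.keys q"
  have "linear_ext f r = (\<Sum>w\<in>?S. of_rat (Poly_Mapping.lookup r w) * f w)"
    if "Poly_Mapping.keys r \<subseteq> ?S" for r
    using that by (intro linear_ext_superset) auto
  from this[of p] this[of q] this[of "p + q"] show ?thesis
    by (simp add: keys_add lookup_add of_rat_add algebra_simps sum.distrib)
qed

lemma lookup_scale [simp]: "Poly_Mapping.lookup (scale c p) w = c * Poly_Mapping.lookup p w"
  unfolding scale_def by transfer (simp add: when_def)

lemma keys_scale: "Poly_Mapping.keys (scale c p) \<subseteq> Poly_Mapping.keys p"
  by (auto simp: in_keys_iff)

lemma scale_one [simp]: "scale 1 p = p"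
  by (rule poly_mapping_eqI) simp

lemma linear_ext_scale: "linear_ext f (scale c p) = of_rat c * linear_ext f p"
proof -
  have "linear_ext f (scale c p) =
      (\<Sum>w\<in>Poly_Mapping.keys p. of_rat (Poly_Mapping.lookup (scale c p) w) * f w)"
    by (rule linear_ext_superset) (simp_all add: keys_scale)
  then show ?thesis
    by (simp add: linear_ext_def of_rat_mult sum_distrib_left mult.assoc)
qed

lemma linear_ext_word [simp]: "linear_ext f (word w) = f w"
  by (simp add: linear_ext_def)

lemma linear_ext_sum: "linear_ext f (sum g S) = (\<Sum>i\<in>S. linear_ext f (g i))"
  by (induction S rule: infinite_finite_induct) (auto simp: linear_ext_add)

lemma linear_ext_fun_zero [simp]: "linear_ext (\<lambda>w. 0) p = 0"
  by (simp add: linear_ext_def)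

lemma linear_ext_fun_add: "linear_ext (\<lambda>w. f w + g w) p = linear_ext f p + linear_ext g p"
  by (simp add: linear_ext_def algebra_simps sum.distrib)

lemma linear_ext_fun_cmult: "linear_ext (\<lambda>w. c * f w) p = c * linear_ext f p"
  by (simp add: linear_ext_def algebra_simps sum_distrib_left)

lemma linear_ext_fun_sum: "linear_ext (\<lambda>w. \<Sum>i\<in>S. f i w) p = (\<Sum>i\<in>S. linear_ext (f i) p)"
  unfolding linear_ext_def by (simp add: sum_distrib_left sum.swap[of _ S])

lemma lookup_prepend:
  "Poly_Mapping.lookup (prepend a p) w =
    (case w of [] \<Rightarrow> 0 | b # v \<Rightarrow> if b = a then Poly_Mapping.lookup p v else 0)"
  unfolding prepend_def lookup_sum
  by (cases w) (auto simp: lookup_single when_def in_keys_iff sum.delta' cong: if_cong)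

lemma prepend_add: "prepend a (p + q) = prepend a p + prepend a q"
  by (rule poly_mapping_eqI) (simp add: lookup_prepend lookup_add split: list.splits)

lemma prepend_scale: "prepend a (scale c p) = scale c (prepend a p)"
  by (rule poly_mapping_eqI) (simp add: lookup_prepend split: list.splits)

lemma prepend_word: "prepend a (word w) = word (a # w)"
  by (simp add: prepend_def)

lemma keys_prepend: "Poly_Mapping.keys (prepend a p) = (#) a ` Poly_Mapping.keys p"
  by (auto simp: in_keys_iff lookup_prepend split: list.splits if_splits)

lemma linear_ext_prepend: "linear_ext f (prepend a p) = linear_ext (\<lambda>w. f (a # w)) p"
  unfolding linear_ext_def keys_prepend
  by (subst sum.reindex) (auto simp: lookup_prepend)

lemma poly_mapping_sum_words:
  "p = (\<Sum>w\<in>Poly_Mapping.keys p. scale (Poly_Mapping.lookup p w) (word w))"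
  by (rule poly_mapping_eqI)
    (auto simp: lookup_sum lookup_single when_def in_keys_iff sum.delta' if_distrib cong: if_cong)

lemma bilinear_ext_words [simp]: "bilinear_ext g (word u) (word v) = g u v"
  by (simp add: bilinear_ext_def)

lemma keys_bilinear_ext:
  "Poly_Mapping.keys (bilinear_ext g p q) \<subseteq>
    (\<Union>u\<in>Poly_Mapping.keys p. \<Union>v\<in>Poly_Mapping.keys q. Poly_Mapping.keys (g u v))"
  unfolding bilinear_ext_def
  by (intro order_trans[OF keys_sum] UN_mono order_refl keys_scale)

text \<open>Multiplicativity is asked only for words in the two supports, since the product formula
  for polylogarithms is available only for words that do not end in the letter 0.\<close>

lemma linear_ext_bilinear_ext:
  assumes "\<And>u v. u \<in> Poly_Mapping.keys p \<Longrightarrow> v \<in> Poly_Mapping.keys q \<Longrightarrow>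
    linear_ext f (g u v) = f u * f v"
  shows "linear_ext f (bilinear_ext g p q) = linear_ext f p * linear_ext f q"
  unfolding bilinear_ext_def linear_ext_sum linear_ext_scale
  by (simp add: linear_ext_def[of _ p] linear_ext_def[of _ q] assms sum_product of_rat_mult
      mult_ac cong: sum.cong)

subsection \<open>Regularization\<close>

lemma span_words_add: "p \<in> span_words W \<Longrightarrow> q \<in> span_words W \<Longrightarrow> p + q \<in> span_words W"
  using keys_add[of p q] by (auto simp: span_words_def)

lemma span_words_scale: "p \<in> span_words W \<Longrightarrow> scale c p \<in> span_words W"
  using keys_scale[of c p] by (auto simp: span_words_def)

lemma word_in_span_words [simp]: "word w \<in> span_words W \<longleftrightarrow> w \<in> W"
  by (auto simp: span_words_def)

text \<open>Requiring decay against all powers makes these sequences closed under multiplication by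
  polynomials in \<open>L\<close>; mere convergence to 0 could be lost after one factor
  \<open>L\<close>.\<close>

definition negligible_wrt :: "(nat \<Rightarrow> complex) \<Rightarrow> (nat \<Rightarrow> complex) \<Rightarrow> bool" where
  "negligible_wrt L e \<longleftrightarrow> (\<forall>k. (\<lambda>n. e n * L n ^ k) \<longlonglongrightarrow> 0)"

lemma negligible_wrt_add:
  "negligible_wrt L e \<Longrightarrow> negligible_wrt L f \<Longrightarrow> negligible_wrt L (\<lambda>n. e n + f n)"
  unfolding negligible_wrt_def by (auto simp: distrib_right intro: tendsto_add_zero)

lemma negligible_wrt_cmult: "negligible_wrt L e \<Longrightarrow> negligible_wrt L (\<lambda>n. c * e n)"
  unfolding negligible_wrt_def by (auto simp: mult.assoc intro: tendsto_mult_right_zero)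

lemma negligible_wrt_diff:
  "negligible_wrt L e \<Longrightarrow> negligible_wrt L f \<Longrightarrow> negligible_wrt L (\<lambda>n. e n - f n)"
  using negligible_wrt_add[OF _ negligible_wrt_cmult, of L e f "-1"] by simp

lemma negligible_wrt_zero [simp]: "negligible_wrt L (\<lambda>n. 0)"
  by (simp add: negligible_wrt_def)

lemma negligible_wrt_mult:
  assumes "negligible_wrt L e" "negligible_wrt L f"
  shows "negligible_wrt L (\<lambda>n. e n * f n)"
  unfolding negligible_wrt_def
proof
  fix k
  have "(\<lambda>n. e n * L n ^ 0) \<longlonglongrightarrow> 0" "(\<lambda>n. f n * L n ^ k) \<longlonglongrightarrow> 0"
    using assms unfolding negligible_wrt_def by blast+
  from tendsto_mult_zero[OF this] show "(\<lambda>n. e n * f n * L n ^ k) \<longlonglongrightarrow> 0"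
    by (simp add: mult_ac)
qed

lemma negligible_wrt_times_base:
  assumes "negligible_wrt L e"
  shows "negligible_wrt L (\<lambda>n. L n * e n)"
  unfolding negligible_wrt_def
proof
  fix k
  have "(\<lambda>n. e n * L n ^ Suc k) \<longlonglongrightarrow> 0" using assms unfolding negligible_wrt_def by blast
  then show "(\<lambda>n. L n * e n * L n ^ k) \<longlonglongrightarrow> 0" by (simp add: mult_ac)
qed

lemma negligible_wrt_poly_mult:
  assumes "negligible_wrt L e"
  shows "negligible_wrt L (\<lambda>n. poly P (L n) * e n)"
proof (induction P)
  case (pCons a P)
  have "negligible_wrt L (\<lambda>n. a * e n + L n * (poly P (L n) * e n))"
    by (intro negligible_wrt_add negligible_wrt_cmult negligible_wrt_times_base assms pCons)
  then show ?case by (simp add: algebra_simps)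
qed simp

lemma negligible_wrt_poly_imp_zero:
  assumes "filterlim L at_infinity sequentially" "negligible_wrt L (\<lambda>n. poly P (L n))"
  shows "P = 0"
proof (rule ccontr)
  assume "P \<noteq> 0"
  \<comment> \<open>The extra factor X makes the polynomial nonconstant, hence large at infinity
    even when \<open>P\<close> is a nonzero constant. The power 1 of \<open>L\<close> in the decay
    below compensates for it.\<close>
  then obtain r where r: "\<And>z. r \<le> norm z \<Longrightarrow> 1 \<le> norm (poly (pCons 0 P) z)"
    using poly_infinity by blast
  have "(\<lambda>n. poly P (L n) * L n ^ 1) \<longlonglongrightarrow> 0"
    using assms(2) unfolding negligible_wrt_def by blast
  then have "\<forall>\<^sub>F n in sequentially. norm (poly P (L n) * L n) < 1"
    by (auto simp: tendsto_iff dest: spec[of _ 1])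
  moreover have "\<forall>\<^sub>F n in sequentially. norm (L n) \<ge> max r 1"
  proof -
    have "max r 1 > 0" by simp
    then show ?thesis using filterlim_at_infinity[of 0 L sequentially] assms(1) by blast
  qed
  ultimately have "\<forall>\<^sub>F n in sequentially. False"
    by eventually_elim (use r in \<open>fastforce simp: norm_mult mult.commute\<close>)
  then show False by simp
qed

text \<open>\<open>F n w\<close> is the n-th approximation to the value of \<open>w\<close>, and
  \<open>x\<close> is the single divergent letter. Only the product with \<open>x\<close> needs a
  recursion: \<open>x\<close> stays in front, or passes behind the first letter \<open>b\<close>, or
  merges with \<open>b\<close>. The merged term \<open>E\<close> must not begin with
  \<open>x\<close>; this keeps it convergent and lets the deletion of a leading \<open>x\<close>
  annihilate it.\<close>

locale regularization =
  fixes W :: "'a list set" and x :: 'a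
    and mulw :: "'a list \<Rightarrow> 'a list \<Rightarrow> ('a list \<Rightarrow>\<^sub>0 rat)"
    and F :: "nat \<Rightarrow> 'a list \<Rightarrow> complex" and \<zeta> :: "'a list \<Rightarrow> complex"
    and E :: "'a \<Rightarrow> 'a list \<Rightarrow> ('a list \<Rightarrow>\<^sub>0 rat)"
  assumes Nil_in: "[] \<in> W"
    and Cons_in: "w \<in> W \<Longrightarrow> x # w \<in> W"
    and tl_in: "b # v \<in> W \<Longrightarrow> v \<in> W"
    and mulw_in: "u \<in> W \<Longrightarrow> v \<in> W \<Longrightarrow> mulw u v \<in> span_words W"
    and mulw_Nil: "mulw [x] [] = word [x]"
    and mulw_Cons: "b # v \<in> W \<Longrightarrow>
      mulw [x] (b # v) = word (x # b # v) + prepend b (mulw [x] v) + E b v"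
    and prepend_in: "b # v \<in> W \<Longrightarrow> prepend b (mulw [x] v) \<in> span_words W"
    and E_in: "b # v \<in> W \<Longrightarrow> E b v \<in> span_words {w \<in> W. w = [] \<or> hd w \<noteq> x}"
    and F_Nil: "F n [] = 1"
    and F_mult: "u \<in> W \<Longrightarrow> v \<in> W \<Longrightarrow> linear_ext (F n) (mulw u v) = F n u * F n v"
    and F_zeta: "w \<in> W \<Longrightarrow> w = [] \<or> hd w \<noteq> x \<Longrightarrow>
      negligible_wrt (\<lambda>n. F n [x]) (\<lambda>n. F n w - \<zeta> w)"
    and F_infinity: "filterlim (\<lambda>n. F n [x]) at_infinity sequentially"
begin

definition W0 :: "'a list set" where
  "W0 = {w \<in> W. w = [] \<or> hd w \<noteq> x}"

lemma word_decomposition: "w \<in> W \<Longrightarrow> \<exists>k v. w = replicate k x @ v \<and> v \<in> W0"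
proof (induction w)
  case Nil
  then show ?case by (auto simp: W0_def)
next
  case (Cons b w)
  show ?case
  proof (cases "b = x")
    case True
    obtain k v where "w = replicate k x @ v" "v \<in> W0"
      using Cons tl_in by blast
    then have "b # w = replicate (Suc k) x @ v" using True by simp
    with \<open>v \<in> W0\<close> show ?thesis by blast
  next
    case False
    then have "b # w = replicate 0 x @ (b # w)" "b # w \<in> W0" using Cons by (auto simp: W0_def)
    then show ?thesis by blast
  qed
qed

lemma replicate_in: "v \<in> W0 \<Longrightarrow> replicate k x @ v \<in> W"
  by (induction k) (auto simp: W0_def Cons_in)

text \<open>Inserting one more \<open>x\<close> into a run of k letters \<open>x\<close> gives the
  same word at each of k + 1 places. Insertions after the run leave k leading letters, and merged
  terms have at most k.\<close>

lemma mulw_replicate: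
  assumes "v \<in> W0"
  shows "\<exists>R. mulw [x] (replicate k x @ v) =
      scale (of_nat (Suc k)) (word (replicate (Suc k) x @ v)) + R \<and>
    R \<in> span_words {replicate j x @ u | j u. j \<le> k \<and> u \<in> W0}"
proof (induction k)
  case 0
  show ?case
  proof (cases v)
    case Nil
    then show ?thesis using mulw_Nil by (intro exI[of _ 0]) (auto simp: span_words_def)
  next
    case (Cons b u)
    then have "b \<noteq> x" "b # u \<in> W" using assms by (auto simp: W0_def)
    have "prepend b (mulw [x] u) \<in> span_words W0"
      using prepend_in[OF \<open>b # u \<in> W\<close>] \<open>b \<noteq> x\<close>
      by (auto simp: span_words_def keys_prepend W0_def)
    then have "prepend b (mulw [x] u) + E b u \<in> span_words W0"
      using E_in[OF \<open>b # u \<in> W\<close>] by (auto simp: W0_def intro: span_words_add)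
    then show ?thesis using mulw_Cons[OF \<open>b # u \<in> W\<close>] Cons
      by (intro exI[of _ "prepend b (mulw [x] u) + E b u"]) (simp add: add.assoc)
  qed
next
  case (Suc k)
  let ?w = "replicate k x @ v"
  obtain R where R: "mulw [x] ?w = scale (of_nat (Suc k)) (word (x # ?w)) + R"
    "R \<in> span_words {replicate j x @ u | j u. j \<le> k \<and> u \<in> W0}"
    using Suc by auto
  have w: "x # ?w \<in> W" using replicate_in[OF assms, of "Suc k"] by simp
  have "prepend x R \<in> span_words {replicate j x @ u | j u. j \<le> Suc k \<and> u \<in> W0}"
  proof -
    have "x # u \<in> {replicate j x @ u | j u. j \<le> Suc k \<and> u \<in> W0}"
      if u: "u \<in> Poly_Mapping.keys R" for u
    proof -
      obtain j v where "u = replicate j x @ v" "j \<le> k" "v \<in> W0"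
        using R(2) u unfolding span_words_def by blast
      then have "x # u = replicate (Suc j) x @ v" "Suc j \<le> Suc k" by auto
      with \<open>v \<in> W0\<close> show ?thesis by blast
    qed
    then show ?thesis by (simp add: span_words_def keys_prepend image_subset_iff)
  qed
  moreover have "E x ?w \<in> span_words {replicate j x @ u | j u. j \<le> Suc k \<and> u \<in> W0}"
    using E_in[OF w] unfolding span_words_def W0_def by (fastforce intro: exI[of _ 0])
  moreover have "word v + scale c (word v) = scale (1 + c) (word v)" for v :: "'a list" and c
    by (rule poly_mapping_eqI) (simp add: lookup_add algebra_simps)
  then have "mulw [x] (x # ?w) =
      scale (of_nat (Suc (Suc k))) (word (x # x # ?w)) + (prepend x R + E x ?w)"
    unfolding mulw_Cons[OF w] R(1) prepend_add prepend_scale prepend_word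
    by (simp add: add.assoc[symmetric])
  ultimately show ?case
    by (intro exI[of _ "prepend x R + E x ?w"]) (auto intro: span_words_add)
qed

text \<open>The free algebra is generated by \<open>x\<close> over the convergent words: the product of \<open>x\<close> with
  \<open>x\<^sup>k v\<close> is \<open>(k + 1) x\<^bsup>k+1\<^esup> v\<close> up to words beginning with fewer letters \<open>x\<close>.\<close>

lemma span_words_induct [consumes 1, case_names add scale base step]:
  assumes "p \<in> span_words W"
    and add: "\<And>p q. p \<in> span_words W \<Longrightarrow> q \<in> span_words W \<Longrightarrow> P p \<Longrightarrow> P q \<Longrightarrow> P (p + q)"
    and scale: "\<And>c p. p \<in> span_words W \<Longrightarrow> P p \<Longrightarrow> P (scale c p)"
    and base: "\<And>w. w \<in> W0 \<Longrightarrow> P (word w)"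
    and step: "\<And>w. w \<in> W \<Longrightarrow> P (word w) \<Longrightarrow> P (mulw [x] w)"
  shows "P p"
proof -
  have scale0: "scale 0 q = 0" for q :: "'a list \<Rightarrow>\<^sub>0 rat"
    by (rule poly_mapping_eqI) simp
  \<comment> \<open>The principle has no case for 0, which is reached as a multiple of the empty
    word.\<close>
  have "P 0"
    using scale[of "word []" 0] base[of "[]"] Nil_in by (simp add: W0_def scale0)
  have comb: "P q" if "q \<in> span_words V" "V \<subseteq> W" "\<And>w. w \<in> V \<Longrightarrow> P (word w)" for q V
  proof -
    have "P (sum f S) \<and> sum f S \<in> span_words W"
      if "\<And>w. w \<in> S \<Longrightarrow> P (f w) \<and> f w \<in> span_words W" for f :: "'a list \<Rightarrow> _" and S
      using that
    proof (induction S rule: infinite_finite_induct)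
      case (insert w S)
      then have "P (sum f S)" "sum f S \<in> span_words W" "P (f w)" "f w \<in> span_words W"
        by blast+
      then show ?case using insert.hyps by (simp add: add span_words_add)
    qed (simp_all add: \<open>P 0\<close>, simp_all add: span_words_def)
    note sums = this
    have "P (\<Sum>w\<in>Poly_Mapping.keys q. scale (Poly_Mapping.lookup q w) (word w))"
    proof (rule sums[THEN conjunct1])
      fix w assume "w \<in> Poly_Mapping.keys q"
      then have "w \<in> V" using that(1) by (auto simp: span_words_def)
      then have "P (word w)" "word w \<in> span_words W" using that by auto
      then show "P (scale (Poly_Mapping.lookup q w) (word w)) \<and>
          scale (Poly_Mapping.lookup q w) (word w) \<in> span_words W"
        by (blast intro: scale span_words_scale)
    qed
    then show ?thesis using poly_mapping_sum_words[of q] by simp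
  qed
  have words: "P (word (replicate k x @ v))" if "v \<in> W0" for k v
    using that
  proof (induction k arbitrary: v rule: less_induct)
    case (less k)
    show ?case
    proof (cases k)
      case 0
      then show ?thesis using base less by simp
    next
      case (Suc m)
      let ?c = "of_nat (Suc m) :: rat"
      obtain R where R: "mulw [x] (replicate m x @ v) = scale ?c (word (replicate k x @ v)) + R"
        "R \<in> span_words {replicate j x @ u | j u. j \<le> m \<and> u \<in> W0}"
        using mulw_replicate[OF less.prems, of m] Suc by auto
      have sub: "{replicate j x @ u | j u. j \<le> m \<and> u \<in> W0} \<subseteq> W" using replicate_in by auto
      then have RW: "R \<in> span_words W" using R(2) by (auto simp: span_words_def)
      have "P R" by (rule comb[OF R(2) sub]) (use less Suc in auto)
      moreover have m: "P (mulw [x] (replicate m x @ v))"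
        using less Suc by (intro step replicate_in) auto
      moreover have "[x] \<in> W" using Cons_in Nil_in by simp
      then have "mulw [x] (replicate m x @ v) \<in> span_words W"
        using replicate_in less by (intro mulw_in) auto
      \<comment> \<open>Solving for the word with the longest run means dividing by k, which is
        possible over the rationals.\<close>
      ultimately have
        "P (scale (1 / ?c) (mulw [x] (replicate m x @ v) + scale (-1) R))"
        using RW by (intro scale add span_words_add span_words_scale) auto
      also have "scale (1 / ?c) (mulw [x] (replicate m x @ v) + scale (-1) R) =
          word (replicate k x @ v)"
        unfolding R(1) by (rule poly_mapping_eqI) (simp add: lookup_add del: of_nat_Suc)
      finally show ?thesis .
    qed
  qed
  show ?thesis
    by (rule comb[OF assms(1) subset_refl]) (use word_decomposition words in blast)
qed

section \<open>Asymptotic expansions in the divergent value\<close>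

abbreviation L :: "nat \<Rightarrow> complex" where "L n \<equiv> F n [x]"

definition asymptotic_poly :: "('a list \<Rightarrow>\<^sub>0 rat) \<Rightarrow> complex poly \<Rightarrow> bool" where
  "asymptotic_poly p P \<longleftrightarrow> negligible_wrt L (\<lambda>n. linear_ext (F n) p - poly P (L n))"

lemma asymptotic_poly_unique:
  assumes "asymptotic_poly p P" "asymptotic_poly p Q"
  shows "P = Q"
proof -
  have "negligible_wrt L (\<lambda>n. poly (Q - P) (L n))"
    using negligible_wrt_diff[OF assms[unfolded asymptotic_poly_def]]
    by (simp add: algebra_simps)
  from negligible_wrt_poly_imp_zero[OF F_infinity this] show ?thesis by simp
qed

lemma asymptotic_poly_add:
  assumes "asymptotic_poly p P" "asymptotic_poly q Q"
  shows "asymptotic_poly (p + q) (P + Q)"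
  using negligible_wrt_add[OF assms[unfolded asymptotic_poly_def]]
  unfolding asymptotic_poly_def by (simp add: linear_ext_add algebra_simps)

lemma asymptotic_poly_scale:
  assumes "asymptotic_poly p P"
  shows "asymptotic_poly (scale c p) (smult (of_rat c) P)"
  using negligible_wrt_cmult[OF assms[unfolded asymptotic_poly_def], of "of_rat c"]
  unfolding asymptotic_poly_def by (simp add: linear_ext_scale algebra_simps)

lemma linear_ext_mul:
  assumes "p \<in> span_words W" "q \<in> span_words W"
  shows "linear_ext (F n) (bilinear_ext mulw p q) = linear_ext (F n) p * linear_ext (F n) q"
  using assms by (intro linear_ext_bilinear_ext F_mult) (auto simp: span_words_def)

lemma asymptotic_poly_mult:
  assumes "asymptotic_poly p P" "asymptotic_poly q Q" "p \<in> span_words W" "q \<in> span_words W"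
  shows "asymptotic_poly (bilinear_ext mulw p q) (P * Q)"
proof -
  let ?e = "\<lambda>n. linear_ext (F n) p - poly P (L n)"
  let ?f = "\<lambda>n. linear_ext (F n) q - poly Q (L n)"
  \<comment> \<open>With errors e and f this is (P + e)(Q + f) - P Q; the polynomial factors are
    absorbed because the errors beat every power of \<open>L\<close>.\<close>
  have "negligible_wrt L (\<lambda>n. ?e n * ?f n + (poly Q (L n) * ?e n + poly P (L n) * ?f n))"
    using assms(1,2) unfolding asymptotic_poly_def
    by (intro negligible_wrt_add negligible_wrt_mult negligible_wrt_poly_mult)
  then show ?thesis
    unfolding asymptotic_poly_def linear_ext_mul[OF assms(3,4)] by (simp add: algebra_simps)
qed

lemma asymptotic_poly_x: "asymptotic_poly (word [x]) [:0, 1:]"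
  by (simp add: asymptotic_poly_def)

lemma asymptotic_poly_convergent: "w \<in> W0 \<Longrightarrow> asymptotic_poly (word w) [:\<zeta> w:]"
  using F_zeta by (simp add: asymptotic_poly_def W0_def)

lemma asymptotic_poly_exists: "p \<in> span_words W \<Longrightarrow> \<exists>P. asymptotic_poly p P"
proof (induction rule: span_words_induct)
  case (step w)
  then show ?case
    using asymptotic_poly_mult[OF asymptotic_poly_x, of "word w"] Cons_in Nil_in by auto
qed (blast intro: asymptotic_poly_add asymptotic_poly_scale asymptotic_poly_convergent)+

text \<open>Shaped so that, once \<open>W0\<close> is identified, its instances are the conditions
  in the descriptions \<open>zeta_stuffle_hom\<close> and \<open>zeta_shuffle_hom\<close>.\<close>

definition regularized :: "(('a list \<Rightarrow>\<^sub>0 rat) \<Rightarrow> complex poly) \<Rightarrow> bool" where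
  "regularized Z \<longleftrightarrow> Z \<in> extensional (span_words W) \<and>
    algebra_hom (span_words W) (bilinear_ext mulw) Z \<and>
    (\<forall>w\<in>W0. Z (word w) = [:\<zeta> w:]) \<and> Z (word [x]) = [:0, 1:]"

text \<open>The asymptotic polynomial itself is the homomorphism: it is unique, and the
  approximations \<open>F n\<close> are already linear and multiplicative, so all rules pass to
  it.\<close>

lemma regularized_exists: "\<exists>Z. regularized Z"
proof -
  define Z where "Z = restrict (\<lambda>p. THE P. asymptotic_poly p P) (span_words W)"
  have Z: "Z p = P" if "asymptotic_poly p P" "p \<in> span_words W" for p P
    unfolding Z_def using that by (auto intro: asymptotic_poly_unique)
  have as: "asymptotic_poly p (Z p)" if "p \<in> span_words W" for p
    using asymptotic_poly_exists[OF that] Z that by metis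
  have mul: "bilinear_ext mulw p q \<in> span_words W"
    if "p \<in> span_words W" "q \<in> span_words W" for p q
    using that keys_bilinear_ext[of mulw p q] mulw_in unfolding span_words_def by blast
  have "asymptotic_poly (word []) 1"
    by (simp add: asymptotic_poly_def F_Nil)
  then have "Z (word []) = 1" using Nil_in by (intro Z) auto
  moreover have "Z (p + q) = Z p + Z q" "Z (scale c p) = smult (of_rat c) (Z p)"
    "Z (bilinear_ext mulw p q) = Z p * Z q"
    if "p \<in> span_words W" "q \<in> span_words W" for p q c
    using that Z as mul asymptotic_poly_add asymptotic_poly_scale asymptotic_poly_mult
        span_words_add span_words_scale by metis+
  moreover have "Z (word w) = [:\<zeta> w:]" if "w \<in> W0" for w
    using that by (intro Z asymptotic_poly_convergent) (auto simp: W0_def)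
  moreover have "Z (word [x]) = [:0, 1:]"
    using Nil_in Cons_in by (intro Z asymptotic_poly_x) auto
  moreover have "Z \<in> extensional (span_words W)" by (simp add: Z_def)
  ultimately have "regularized Z"
    using Nil_in unfolding regularized_def algebra_hom_def by blast
  then show ?thesis by blast
qed

lemma regularized_mulw_x:
  assumes "regularized Z" "w \<in> W"
  shows "Z (mulw [x] w) = [:0, 1:] * Z (word w)"
proof -
  have "Z (bilinear_ext mulw (word [x]) (word w)) = Z (word [x]) * Z (word w)"
    using assms Cons_in Nil_in unfolding regularized_def algebra_hom_def
    by (metis word_in_span_words)
  then show ?thesis using assms(1) by (simp add: regularized_def)
qed

text \<open>Two candidates agree on the convergent words, and the product with \<open>x\<close>
  multiplies both by T; by the induction principle this determines them.\<close>

lemma regularized_unique: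
  assumes Y: "regularized Y" and Z: "regularized Z"
  shows "Y = Z"
proof
  fix p
  show "Y p = Z p"
  proof (cases "p \<in> span_words W")
    case True
    then show ?thesis
    proof (induction rule: span_words_induct)
      case (step w)
      then show ?case by (simp add: regularized_mulw_x[OF Y] regularized_mulw_x[OF Z])
    qed (use Y Z in \<open>auto simp: regularized_def algebra_hom_def\<close>)
  next
    case False
    then show ?thesis using Y Z by (auto simp: regularized_def extensional_def)
  qed
qed

lemma regularized_the: "regularized (THE Z. regularized Z)"
  using regularized_exists regularized_unique by (metis theI)

lemma pderiv_regularized_convergent:
  assumes "regularized Z" "w \<in> W" "w = [] \<or> hd w \<noteq> x"
  shows "pderiv (Z (word w)) = 0"
  using assms by (auto simp: regularized_def W0_def)

text \<open>The derivative of \<open>Z\<close> and the composition of \<open>Z\<close> with the deletion of a leading \<open>x\<close>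
  obey the same product rule for the multiplication by \<open>x\<close>.\<close>

lemma pderiv_regularized:
  assumes Z: "regularized Z" and "w \<in> W"
  shows "pderiv (Z (word (x # w))) = Z (word w)"
proof -
  \<comment> \<open>\<open>D t\<close> is the value at t after deletion of a leading
    \<open>x\<close>, and 0 if there is none. A number t is inserted because
    \<open>linear_ext\<close> takes complex values.\<close>
  define D where
    "D t v = (case v of [] \<Rightarrow> 0 | b # u \<Rightarrow> if b = x then poly (Z (word u)) t else 0)" for t v
  have hom: "Z (p + q) = Z p + Z q" "Z (scale c p) = smult (of_rat c) (Z p)"
    if "p \<in> span_words W" "q \<in> span_words W" for p q c
    using Z that by (auto simp: regularized_def algebra_hom_def)
  have lin: "linear_ext (\<lambda>v. poly (Z (word v)) t) p = poly (Z p) t" if "p \<in> span_words W" for p t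
    using that
  proof -
    have "poly (Z (sum f S)) t = (\<Sum>i\<in>S. poly (Z (f i)) t) \<and> sum f S \<in> span_words W"
      if "finite S" "S \<noteq> {}" "\<And>i. i \<in> S \<Longrightarrow> f i \<in> span_words W"
      for S and f :: "'a list \<Rightarrow> _"
      using that by (induction S rule: finite_ne_induct) (auto simp: hom span_words_add)
    note sums = this
    have keys: "word w \<in> span_words W" if "w \<in> Poly_Mapping.keys p" for w
      using that \<open>p \<in> span_words W\<close> by (auto simp: span_words_def)
    have "poly (Z p) t = linear_ext (\<lambda>v. poly (Z (word v)) t) p" if "p \<noteq> 0"
    proof -
      have "poly (Z (\<Sum>w\<in>Poly_Mapping.keys p. scale (Poly_Mapping.lookup p w) (word w))) t =
          (\<Sum>w\<in>Poly_Mapping.keys p. poly (Z (scale (Poly_Mapping.lookup p w) (word w))) t)"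
        using that
        by (intro sums[THEN conjunct1]) (auto intro: span_words_scale keys)
      also have "\<dots> = linear_ext (\<lambda>v. poly (Z (word v)) t) p"
        unfolding linear_ext_def by (intro sum.cong) (simp_all add: hom(2)[OF keys keys])
      finally show ?thesis using poly_mapping_sum_words[of p] by simp
    qed
    moreover have "Z 0 = 0"
      using hom(1)[of 0 0] by (simp add: span_words_def)
    ultimately show ?thesis by (cases "p = 0") auto
  qed
  have DE: "linear_ext (D t) (E b v) = 0" if "b # v \<in> W" for b v t
    using E_in[OF that] unfolding linear_ext_def
    by (intro sum.neutral) (auto simp: span_words_def D_def split: list.splits)
  \<comment> \<open>This mirrors the product rule for T times \<open>Z (word w)\<close>. The word
    with \<open>x\<close> in front contributes the value of \<open>w\<close>. If \<open>w\<close>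
    begins with \<open>x\<close>, deleting that letter from the second term leaves the product of
    \<open>x\<close> with the rest, whose value is t times that of the rest. Merged terms vanish
    under \<open>D\<close>.\<close>
  have D_mul: "linear_ext (D t) (mulw [x] w) = poly (Z (word w)) t + t * D t w"
    if "w \<in> W" for w t
  proof (cases w)
    case Nil
    then show ?thesis by (simp add: mulw_Nil D_def)
  next
    case (Cons b v)
    then have bv: "b # v \<in> W" and v: "v \<in> W" using that tl_in by auto
    have "linear_ext (D t) (prepend b (mulw [x] v)) = t * D t w"
    proof (cases "b = x")
      case True
      have "mulw [x] v \<in> span_words W" using v Cons_in Nil_in by (intro mulw_in) auto
      then show ?thesis using True Cons regularized_mulw_x[OF Z v]
        by (simp add: linear_ext_prepend D_def lin)
    next
      case False
      then show ?thesis using Cons by (simp add: linear_ext_prepend D_def)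
    qed
    then show ?thesis
      using Cons by (simp add: mulw_Cons[OF bv] linear_ext_add DE[OF bv]) (simp add: D_def)
  qed
  have "\<forall>t. poly (pderiv (Z p)) t = linear_ext (D t) p" if "p \<in> span_words W" for p
    using that
  proof (induction rule: span_words_induct)
    case (add p q)
    then show ?case by (simp add: hom pderiv_add linear_ext_add)
  next
    case (scale c p)
    then show ?case by (simp add: hom pderiv_smult linear_ext_scale)
  next
    case (base w)
    then show ?case
      using Z by (auto simp: regularized_def W0_def D_def pderiv_pCons split: list.splits)
  next
    case (step w)
    then show ?case
      by (simp add: regularized_mulw_x[OF Z] D_mul pderiv_mult pderiv_pCons algebra_simps)
  qed
  from this[of "word (x # w)"] Cons_in[OF \<open>w \<in> W\<close>] show ?thesis
    by (intro poly_eq_poly_eq_iff[THEN iffD1] ext) (simp add: D_def)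
qed

end

subsection \<open>Truncated sums\<close>

lemma cmzv_upto_Nil [simp]: "cmzv_upto [] n = 1"
proof -
  have "{ks :: nat list. length ks = length [] \<and> sorted_wrt (>) ks \<and> set ks \<subseteq> {1..n}} = {[]}"
    by auto
  then show ?thesis by (simp add: cmzv_upto_def)
qed

lemma cmzv_upto_Cons:
  "cmzv_upto ((s, \<eta>) # w) n = (\<Sum>k=1..n. \<eta> ^ k / of_nat k ^ s * cmzv_upto w (k - 1))"
proof -
  define S where "S l n = {ks :: nat list. length ks = l \<and> sorted_wrt (>) ks \<and> set ks \<subseteq> {1..n}}"
    for l n
  have fin: "finite (S l n)" for l n
    by (rule finite_subset[OF _ finite_lists_length_eq[of "{1..n}" l]]) (auto simp: S_def)
  have split: "S (Suc l) n = (\<lambda>(k, ks). k # ks) ` (SIGMA k:{1..n}. S l (k - 1))" for l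
  proof (intro equalityI subsetI)
    fix ks assume "ks \<in> S (Suc l) n"
    then obtain k js where ks: "ks = k # js" "k # js \<in> S (Suc l) n" by (cases ks) (auto simp: S_def)
    then have "k \<in> {1..n}" "js \<in> S l (k - 1)" by (fastforce simp: S_def)+
    then show "ks \<in> (\<lambda>(k, ks). k # ks) ` (SIGMA k:{1..n}. S l (k - 1))" using ks(1) by force
  qed (fastforce simp: S_def)
  define t where "t w ks = (\<Prod>i<length w. snd (w ! i) ^ (ks ! i) / of_nat (ks ! i) ^ fst (w ! i))"
    for w :: index and ks :: "nat list"
  have H: "cmzv_upto w n = sum (t w) (S (length w) n)" for w n
    by (simp add: cmzv_upto_def S_def t_def)
  have t: "t ((s, \<eta>) # w) (k # ks) = \<eta> ^ k / of_nat k ^ s * t w ks" for k ks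
    by (simp add: t_def prod.lessThan_Suc_shift del: prod.lessThan_Suc)
  have "cmzv_upto ((s, \<eta>) # w) n =
      (\<Sum>(k, ks) \<in> (SIGMA k:{1..n}. S (length w) (k - 1)). t ((s, \<eta>) # w) (k # ks))"
    unfolding H list.size add_0_right add_Suc_right split
    by (subst sum.reindex) (auto simp: inj_on_def intro!: sum.cong)
  also have "\<dots> = (\<Sum>k=1..n. \<eta> ^ k / of_nat k ^ s * cmzv_upto w (k - 1))"
    unfolding H sum_distrib_left t[symmetric] by (subst sum.Sigma) (auto simp: fin)
  finally show ?thesis .
qed

lemma cmzv_upto_Cons_0 [simp]: "cmzv_upto (a # w) 0 = 0"
  by (cases a) (simp add: cmzv_upto_Cons)

lemma cmzv_upto_Cons_Suc:
  "cmzv_upto ((s, \<eta>) # w) (Suc n) =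
    cmzv_upto ((s, \<eta>) # w) n + \<eta> ^ Suc n / of_nat (Suc n) ^ s * cmzv_upto w n"
  by (simp add: cmzv_upto_Cons)

text \<open>Passing from n to n + 1 adds the terms with largest summation index n + 1. The increment
  of a product f g is the sum of df g, f dg and df dg, and these are the three terms of the stuffle
  recursion.\<close>

lemma linear_ext_stuffle_words:
  "linear_ext (\<lambda>w. cmzv_upto w n) (stuffle_words u v) = cmzv_upto u n * cmzv_upto v n"
proof (induction n arbitrary: u v)
  case 0
  show ?case
    by (cases "(u, v)" rule: stuffle_words.cases)
      (auto simp: linear_ext_add linear_ext_prepend)
next
  case (Suc n)
  show ?case
  proof (cases "(u, v)" rule: stuffle_words.cases)
    case (3 m \<mu> u' n' \<nu> v')
    then have uv: "u = (m, \<mu>) # u'" "v = (n', \<nu>) # v'" by auto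
    have "linear_ext (\<lambda>w. cmzv_upto w (Suc n)) (prepend (m, \<mu>) p) =
        linear_ext (\<lambda>w. cmzv_upto w n) (prepend (m, \<mu>) p) +
        \<mu> ^ Suc n / of_nat (Suc n) ^ m * linear_ext (\<lambda>w. cmzv_upto w n) p" for m \<mu> p
      unfolding linear_ext_prepend cmzv_upto_Cons_Suc linear_ext_fun_add linear_ext_fun_cmult ..
    then have "linear_ext (\<lambda>w. cmzv_upto w (Suc n)) (stuffle_words u v) =
        linear_ext (\<lambda>w. cmzv_upto w n) (stuffle_words u v) +
        \<mu> ^ Suc n / of_nat (Suc n) ^ m * (cmzv_upto u' n * cmzv_upto v n) +
        \<nu> ^ Suc n / of_nat (Suc n) ^ n' * (cmzv_upto u n * cmzv_upto v' n) +
        (\<mu> * \<nu>) ^ Suc n / of_nat (Suc n) ^ (m + n') * (cmzv_upto u' n * cmzv_upto v' n)"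
      unfolding uv stuffle_words.simps linear_ext_add Suc.IH[symmetric] by simp
    then show ?thesis
      unfolding Suc.IH unfolding uv cmzv_upto_Cons_Suc
      by (simp add: algebra_simps power_add power_mult_distrib del: of_nat_Suc)
  qed auto
qed

subsection \<open>Rate of convergence\<close>

text \<open>A common bound for the two divergent values, the harmonic sum and
  \<open>ln (n + 1)\<close>.\<close>

definition log_growth :: "nat \<Rightarrow> real" where
  "log_growth n = 1 + ln (real n + 1)"

lemma log_growth_ge_1: "log_growth n \<ge> 1"
  by (simp add: log_growth_def)

lemma harm_le_log_growth: "harm n \<le> log_growth n"
proof (cases n)
  case (Suc m)
  \<comment> \<open>\<open>harm n - ln n\<close> decreases for n \<ge> 1 and equals 1 at n =
    1.\<close>
  have "harm (Suc m) - ln (Suc m) \<le> harm (Suc 0) - ln (Suc 0)"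
    using decseqD[OF decseq_harm_diff_ln, of 0 m] by simp
  then have "harm (Suc m) \<le> 1 + ln (real (Suc m))" by (simp add: harm_def)
  also have "\<dots> \<le> log_growth (Suc m)" by (simp add: log_growth_def)
  finally show ?thesis using Suc by simp
qed (simp add: harm_def log_growth_def)

text \<open>With t = \<open>log_growth n / 2\<close> the square root is \<open>exp t\<close> up to a
  constant factor, so this is the decay of t^k / exp t.\<close>

lemma log_growth_power_over_sqrt:
  "(\<lambda>n. log_growth n ^ k / sqrt (real n + 1)) \<longlonglongrightarrow> 0"
proof -
  have lim: "filterlim (\<lambda>n. log_growth n / 2) at_top sequentially"
  proof -
    have "filterlim (\<lambda>n. 1 / 2 * (1 + ln (1 + real n))) at_top sequentially"
      by (intro filterlim_tendsto_pos_mult_at_top[OF tendsto_const]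
          filterlim_tendsto_add_at_top[OF tendsto_const] filterlim_compose[OF ln_at_top]
          filterlim_real_sequentially) simp
    then show ?thesis by (simp add: log_growth_def add.commute)
  qed
  have "exp (log_growth n / 2) = exp (1 / 2) * sqrt (real n + 1)" for n
  proof -
    have "exp (ln (real n + 1) / 2) ^ 2 = real n + 1"
      by (simp add: power2_eq_square flip: exp_add)
    then have "sqrt (real n + 1) = exp (ln (real n + 1) / 2)"
      by (metis exp_ge_zero real_sqrt_unique)
    then show ?thesis by (simp add: log_growth_def add_divide_distrib exp_add)
  qed
  then have "log_growth n ^ k / sqrt (real n + 1) =
      2 ^ k * exp (1 / 2) * ((log_growth n / 2) ^ k / exp (log_growth n / 2))" for n
    by (simp add: power_divide)
  moreover have "(\<lambda>n. 2 ^ k * exp (1 / 2) * ((log_growth n / 2) ^ k / exp (log_growth n / 2)))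
      \<longlonglongrightarrow> 0"
    by (intro tendsto_mult_right_zero filterlim_compose[OF tendsto_power_div_exp_0 lim])
  ultimately show ?thesis by simp
qed

lemma negligible_wrt_log_growth:
  assumes "\<And>n. norm (L n) \<le> log_growth n"
    and "\<And>n. norm (e n) \<le> C * log_growth n / sqrt (real n + 1)"
  shows "negligible_wrt L e"
  unfolding negligible_wrt_def
proof
  fix k
  have "norm (e n * L n ^ k) \<le> C * (log_growth n ^ Suc k / sqrt (real n + 1))" for n
  proof -
    have "norm (e n * L n ^ k) \<le> C * log_growth n / sqrt (real n + 1) * log_growth n ^ k"
      unfolding norm_mult norm_power
      by (rule mult_mono[OF assms(2) power_mono[OF assms(1)]])
        (auto intro: order_trans[OF norm_ge_zero assms(2)])
    then show ?thesis by (simp add: mult_ac)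
  qed
  moreover have "(\<lambda>n. C * (log_growth n ^ Suc k / sqrt (real n + 1))) \<longlonglongrightarrow> 0"
    by (intro tendsto_mult_right_zero log_growth_power_over_sqrt)
  ultimately show "(\<lambda>n. e n * L n ^ k) \<longlonglongrightarrow> 0"
    by (rule Lim_null_comparison[OF always_eventually[OF allI]])
qed

definition unimodular :: "index \<Rightarrow> bool" where
  "unimodular w \<longleftrightarrow> (\<forall>(s, \<eta>) \<in> set w. s \<ge> 1 \<and> norm \<eta> = 1)"

lemma norm_cmzv_upto_le:
  assumes "unimodular w"
  shows "norm (cmzv_upto w n) \<le> harm n ^ length w"
  using assms
proof (induction w arbitrary: n)
  case (Cons a w)
  obtain s \<eta> where a: "a = (s, \<eta>)" by (cases a)
  have s: "s \<ge> 1" "norm \<eta> = 1" and w: "unimodular w" using Cons.prems a by (auto simp: unimodular_def)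
  show ?case
  proof (induction n)
    case (Suc n)
    have "norm (\<eta> ^ Suc n / of_nat (Suc n) ^ s * cmzv_upto w n) \<le>
        inverse (real (Suc n)) * harm (Suc n) ^ length w"
    proof -
      have "real (Suc n) ^ 1 \<le> real (Suc n) ^ s" using s by (intro power_increasing) auto
      then have "norm (\<eta> ^ Suc n / of_nat (Suc n) ^ s) \<le> inverse (real (Suc n))"
        using s by (simp add: norm_divide norm_mult norm_power inverse_eq_divide frac_le
            del: of_nat_Suc)
      moreover have "norm (cmzv_upto w n) \<le> harm (Suc n) ^ length w"
        by (rule order_trans[OF Cons.IH[OF w]]) (intro power_mono harm_mono harm_nonneg le_SucI order_refl)
      ultimately show ?thesis unfolding norm_mult by (intro mult_mono) auto
    qed
    moreover have "harm n * harm n ^ length w \<le> harm n * (harm (Suc n) :: real) ^ length w"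
      by (intro mult_left_mono power_mono harm_mono harm_nonneg) auto
    ultimately show ?case
      using Suc norm_triangle_ineq[of "cmzv_upto (a # w) n" "\<eta> ^ Suc n / of_nat (Suc n) ^ s * cmzv_upto w n"]
      unfolding a cmzv_upto_Cons_Suc by (simp add: harm_Suc algebra_simps del: of_nat_Suc)
  qed (simp add: harm_def)
qed simp

text \<open>Trading the power of the logarithm for a square root makes the order of growth
  independent of the depth.\<close>

lemma norm_cmzv_upto_le_sqrt:
  assumes "unimodular w"
  obtains C where "C \<ge> 0" "\<And>n. norm (cmzv_upto w n) \<le> C * sqrt (real n + 1)"
proof -
  have "Bseq (\<lambda>n. log_growth n ^ length w / sqrt (real n + 1))"
    using log_growth_power_over_sqrt by (intro convergent_imp_Bseq convergentI)
  then obtain C where C: "C > 0" "\<And>n. norm (log_growth n ^ length w / sqrt (real n + 1)) \<le> C"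
    by (auto elim: BseqE)
  have "norm (cmzv_upto w n) \<le> C * sqrt (real n + 1)" for n
  proof -
    have "harm n ^ length w \<le> log_growth n ^ length w"
      by (intro power_mono harm_le_log_growth harm_nonneg)
    with norm_cmzv_upto_le[OF assms, of n] C(2)[of n] show ?thesis
      by (simp add: divide_le_eq)
  qed
  with C(1) show ?thesis by (intro that[of C]) auto
qed

text \<open>Increments of order n^(-3/2) are dominated by the differences of a multiple of n^(-1/2),
  so the tails telescope.\<close>

lemma convergence_rate:
  fixes x :: "nat \<Rightarrow> complex"
  assumes "\<And>n. norm (x (Suc n) - x n) \<le> C / ((real n + 1) * sqrt (real n + 1))"
  obtains l D where "\<And>n. norm (x n - l) \<le> D / sqrt (real n + 1)"
proof -
  \<comment> \<open>For consecutive roots a and b one has 1 / a - 1 / b = 1 / (a b (a + b)), and b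
    \<le> 2 a bounds this denominator by 6 a^3.\<close>
  define d where "d n = 6 * C / sqrt (real n + 1)" for n :: nat
  have C: "C \<ge> 0" using order_trans[OF norm_ge_zero assms[of 0]] by simp
  have step: "norm (x (Suc n) - x n) \<le> d n - d (Suc n)" for n
  proof -
    define a b where "a = sqrt (real n + 1)" and "b = sqrt (real n + 2)"
    have ab: "a > 0" "b > 0" "a\<^sup>2 = real n + 1" "b\<^sup>2 = real n + 2" by (auto simp: a_def b_def)
    have "b \<le> 2 * a" by (rule power2_le_imp_le) (use ab in \<open>auto simp: power_mult_distrib\<close>)
    have "(b - a) * (a + b) = 1" using ab by (simp add: algebra_simps power2_eq_square)
    then have "b - a = 1 / (a + b)" using ab by (simp add: field_simps)
    moreover have "1 / a - 1 / b = (b - a) / (a * b)" using ab by (simp add: field_simps)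
    ultimately have "1 / a - 1 / b = 1 / (a * b * (a + b))" by simp
    moreover have "a * b * (a + b) \<le> a * (2 * a) * (3 * a)"
      using \<open>b \<le> 2 * a\<close> ab by (intro mult_mono) auto
    ultimately have "1 / (6 * (a\<^sup>2 * a)) \<le> 1 / a - 1 / b"
      using ab by (simp add: frac_le power2_eq_square mult_ac)
    then have "6 * C * (1 / (6 * (a\<^sup>2 * a))) \<le> 6 * C * (1 / a - 1 / b)"
      using C by (intro mult_left_mono) auto
    then have "C / (a\<^sup>2 * a) \<le> 6 * C / a - 6 * C / b" by (simp add: right_diff_distrib)
    moreover have "d n - d (Suc n) = 6 * C / a - 6 * C / b"
      by (simp add: d_def a_def b_def add_ac)
    ultimately show ?thesis using assms[of n] ab(3) by (simp add: a_def)
  qed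
  have dist: "norm (x (n + k) - x n) \<le> d n - d (n + k)" for n k
  proof (induction k)
    case (Suc k)
    then show ?case
      using norm_triangle_ineq[of "x (Suc (n + k)) - x (n + k)" "x (n + k) - x n"] step[of "n + k"]
      by simp
  qed simp
  have d_nonneg: "d n \<ge> 0" for n using C by (simp add: d_def)
  have d0: "d \<longlonglongrightarrow> 0"
    using tendsto_mult_right_zero[OF log_growth_power_over_sqrt[of 0], of "6 * C"]
    by (simp add: d_def[abs_def])
  have dist': "norm (x m - x n) \<le> d n" if "n \<le> m" for m n
    using dist[of n "m - n"] d_nonneg[of m] that by simp
  have "Cauchy x"
  proof (rule CauchyI')
    fix e :: real assume "e > 0"
    then obtain M where M: "\<And>n. n \<ge> M \<Longrightarrow> d n < e"
      using order_tendstoD(2)[OF d0] by (auto simp: eventually_sequentially)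
    have "dist (x m) (x n) < e" if "m \<ge> M" "n > m" for m n
      using M[OF that(1)] dist'[of m n] that by (simp add: dist_norm norm_minus_commute)
    then show "\<exists>M. \<forall>m\<ge>M. \<forall>n>m. dist (x m) (x n) < e" by blast
  qed
  then obtain l where l: "x \<longlonglongrightarrow> l" by (auto simp: Cauchy_convergent_iff convergent_def)
  have "norm (x n - l) \<le> d n" for n
  proof -
    have "(\<lambda>m. norm (x n - x m)) \<longlonglongrightarrow> norm (x n - l)" by (intro tendsto_intros l)
    then show ?thesis
      by (rule tendsto_upperbound)
        (auto intro!: eventually_sequentiallyI[of n] simp: norm_minus_commute dist')
  qed
  then show ?thesis by (intro that[of l "6 * C"]) (simp add: d_def)
qed

text \<open>For leading weight at least 2 the increments are already of order n^(-3/2), as the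
  nested sum costs at most sqrt n. For leading weight 1 the color differs from 1, and its
  oscillation has to be exploited.\<close>

lemma cmzv_convergence_rate:
  assumes "unimodular w" "w = [] \<or> hd w \<noteq> (1, 1)"
  obtains D where "D \<ge> 0" "\<And>n. norm (cmzv_upto w n - cmzv w) \<le> D / sqrt (real n + 1)"
proof -
  have "\<exists>l D. \<forall>n. norm (cmzv_upto w n - l) \<le> D / sqrt (real n + 1)"
  proof (cases w)
    case Nil
    then show ?thesis by (intro exI[of _ 1] exI[of _ 0]) simp
  next
    case (Cons a v)
    obtain s \<eta> where a: "a = (s, \<eta>)" by (cases a)
    let ?x = "cmzv_upto ((s, \<eta>) # v)"
    let ?r = "\<lambda>n::nat. sqrt (real n + 1)"
    have r: "?r n > 0" "?r n * ?r n = real n + 1" for n by auto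
    have s: "s \<ge> 1" "norm \<eta> = 1" and v: "unimodular v" and ne: "\<not> (s = 1 \<and> \<eta> = 1)"
      using assms Cons a by (auto simp: unimodular_def)
    have cancel: "1 / (m * (t * t)) * (c * t) = c / (m * t)" if "t > 0" "m > 0" for c m t :: real
      using that by (simp add: field_simps)
    obtain B where B: "B \<ge> 0" "\<And>n. norm (cmzv_upto v n) \<le> B * ?r n"
      using norm_cmzv_upto_le_sqrt[OF v] by blast
    show ?thesis
    proof (cases "s = 1")
      case False
      have "norm (?x (Suc n) - ?x n) \<le> B / ((real n + 1) * ?r n)" for n
      proof -
        have "real (Suc n) ^ 2 \<le> real (Suc n) ^ s" using s False by (intro power_increasing) auto
        then have "1 / real (Suc n) ^ s \<le> 1 / (real n + 1)\<^sup>2"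
          by (intro frac_le) (auto simp: add.commute)
        then have "1 / real (Suc n) ^ s * norm (cmzv_upto v n) \<le> 1 / (real n + 1)\<^sup>2 * (B * ?r n)"
          using B by (intro mult_mono) auto
        also have "(real n + 1)\<^sup>2 = (real n + 1) * (?r n * ?r n)" by (simp add: power2_eq_square)
        also have "1 / ((real n + 1) * (?r n * ?r n)) * (B * ?r n) = B / ((real n + 1) * ?r n)"
          by (rule cancel) (use r(1)[of n] in auto)
        finally show ?thesis
          unfolding cmzv_upto_Cons_Suc using s
          by (simp add: norm_mult norm_divide norm_power del: of_nat_Suc)
      qed
      from convergence_rate[OF this] show ?thesis unfolding Cons a by metis
    next
      case True
      then have "\<eta> \<noteq> 1" using ne by simp
      define q where "q = norm (\<eta> - 1)"
      have q: "q > 0" using \<open>\<eta> \<noteq> 1\<close> by (simp add: q_def)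
      \<comment> \<open>Summation by parts differences the coefficient, so the nested sum has to
        vary slowly: its increments are of order n^(-1/2).\<close>
      have "\<exists>B'\<ge>0. \<forall>n. norm (cmzv_upto v (Suc n) - cmzv_upto v n) \<le> B' * ?r n / (real n + 1)"
      proof (cases v)
        case (Cons b u)
        obtain t \<theta> where b: "b = (t, \<theta>)" by (cases b)
        have t: "t \<ge> 1" "norm \<theta> = 1" and u: "unimodular u"
          using v Cons b by (auto simp: unimodular_def)
        obtain B' where B': "B' \<ge> 0" "\<And>n. norm (cmzv_upto u n) \<le> B' * ?r n"
          using norm_cmzv_upto_le_sqrt[OF u] by blast
        have "norm (cmzv_upto v (Suc n) - cmzv_upto v n) \<le> B' * ?r n / (real n + 1)" for n
        proof -
          have "real (Suc n) ^ 1 \<le> real (Suc n) ^ t" using t by (intro power_increasing) auto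
          then have "1 / real (Suc n) ^ t \<le> 1 / (real n + 1)"
            by (intro frac_le) (auto simp: add.commute)
          then have "1 / real (Suc n) ^ t * norm (cmzv_upto u n) \<le> 1 / (real n + 1) * (B' * ?r n)"
            using B' by (intro mult_mono) auto
          then show ?thesis
            unfolding Cons b cmzv_upto_Cons_Suc using t
            by (simp add: norm_mult norm_divide norm_power del: of_nat_Suc)
        qed
        then show ?thesis using B'(1) by blast
      qed (auto intro: exI[of _ 0])
      then obtain B' where B': "B' \<ge> 0"
        "\<And>n. norm (cmzv_upto v (Suc n) - cmzv_upto v n) \<le> B' * ?r n / (real n + 1)" by blast
      txt \<open>Summation by parts against the bounded primitive \<open>\<eta>\<^sup>n / (\<eta> - 1)\<close> of \<open>\<eta>\<^sup>n\<close>.\<close>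
      define e where "e n = \<eta> ^ n / (\<eta> - 1)" for n
      define a' where "a' n = cmzv_upto v n / of_nat (Suc n)" for n
      \<comment> \<open>Without the boundary term the increments have order n^(-3/2), and the
        boundary term itself has order n^(-1/2).\<close>
      define y where "y n = ?x n - e (Suc n) * a' n" for n
      have norm_e: "norm (e n) = 1 / q" for n
        using s by (simp add: e_def q_def norm_divide norm_power)
      have e_Suc: "e (Suc n) = e n + \<eta> ^ n" for n
        using \<open>\<eta> \<noteq> 1\<close> by (simp add: e_def field_simps)
      have y_Suc: "y (Suc n) - y n = - (e (Suc (Suc n)) * (a' (Suc n) - a' n))" for n
      proof -
        have "?x (Suc n) = ?x n + \<eta> ^ Suc n * a' n"
          unfolding cmzv_upto_Cons_Suc True by (simp add: a'_def)
        then show ?thesis unfolding y_def e_Suc[of "Suc n"] by (simp add: algebra_simps)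
      qed
      have a'_diff: "norm (a' (Suc n) - a' n) \<le> (B' + B) / ((real n + 1) * ?r n)" for n
      proof -
        have id: "x / (m + 1) - y / m = (x - y) / (m + 1) - y / (m * (m + 1))"
          if "m \<noteq> 0" "m + 1 \<noteq> 0" for x y m :: complex
          using that by (simp add: divide_simps) (simp add: algebra_simps)
        have "of_nat (Suc n) + 1 = (of_nat (Suc (Suc n)) :: complex)" by simp
        note id[of "of_nat (Suc n)", unfolded this]
        then have "a' (Suc n) - a' n =
            (cmzv_upto v (Suc n) - cmzv_upto v n) / of_nat (Suc (Suc n)) -
            cmzv_upto v n / (of_nat (Suc n) * of_nat (Suc (Suc n)))"
          unfolding a'_def using of_nat_neq_0 by blast
        also have "norm \<dots> \<le> norm (cmzv_upto v (Suc n) - cmzv_upto v n) / (real n + 2) +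
            norm (cmzv_upto v n) / ((real n + 1) * (real n + 2))"
          by (rule order_trans[OF norm_triangle_ineq4])
            (simp add: norm_divide norm_mult del: of_nat_Suc, simp add: add_ac)
        also have "\<dots> \<le> (B' * ?r n / (real n + 1)) / (real n + 1) +
            (B * ?r n) / ((real n + 1) * (real n + 1))"
          using B B' by (intro add_mono frac_le mult_left_mono mult_nonneg_nonneg divide_nonneg_nonneg) auto
        also have "\<dots> = 1 / ((real n + 1) * (?r n * ?r n)) * ((B' + B) * ?r n)"
          unfolding r(2) by (simp add: distrib_right add_divide_distrib)
        also have "\<dots> = (B' + B) / ((real n + 1) * ?r n)"
          by (rule cancel) (use r(1)[of n] in auto)
        finally show ?thesis .
      qed
      have "norm (y (Suc n) - y n) \<le> (B' + B) / q / ((real n + 1) * ?r n)" for n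
        using mult_left_mono[OF a'_diff[of n], of "1 / q"] q
        by (simp add: y_Suc norm_mult norm_e mult_ac)
      from convergence_rate[OF this]
      obtain l D where D: "\<And>n. norm (y n - l) \<le> D / ?r n" by blast
      have "norm (?x n - l) \<le> (D + B / q) / ?r n" for n
      proof -
        have "norm (e (Suc n) * a' n) \<le> 1 / q * (B * ?r n / (?r n * ?r n))"
          unfolding norm_mult norm_e a'_def norm_divide norm_of_nat
          using B q by (intro mult_left_mono frac_le) auto
        also have "\<dots> = B / q / ?r n" using r(1)[of n] by (simp add: field_simps del: real_sqrt_mult_self)
        finally have "norm (?x n - l) \<le> D / ?r n + B / q / ?r n"
          using norm_triangle_ineq[of "y n - l" "e (Suc n) * a' n"] D[of n] by (simp add: y_def)
        then show ?thesis by (simp add: add_divide_distrib)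
      qed
      then show ?thesis unfolding Cons a by blast
    qed
  qed
  then obtain l D where D: "\<And>n. norm (cmzv_upto w n - l) \<le> D / sqrt (real n + 1)" by blast
  have "D \<ge> 0" using order_trans[OF norm_ge_zero D[of 0]] by simp
  have "(\<lambda>n. D / sqrt (real n + 1)) \<longlonglongrightarrow> 0"
    using tendsto_mult_right_zero[OF log_growth_power_over_sqrt[of 0], of D] by simp
  then have "(\<lambda>n. cmzv_upto w n - l) \<longlonglongrightarrow> 0"
    by (rule Lim_null_comparison[OF always_eventually, rotated]) (use D in blast)
  then have "cmzv_upto w \<longlonglongrightarrow> l" using LIM_zero_iff by blast
  then have "cmzv w = l" by (simp add: cmzv_def limI)
  with D \<open>D \<ge> 0\<close> show ?thesis using that by blast
qed

unbundle no vec_syntax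
unbundle fps_syntax

subsection \<open>Multiple polylogarithms\<close>

text \<open>The series of a X / (1 - a X) for nonzero a. Times dX / X it is the differential form of
  the letter: a dX / (1 - a X), respectively dX / X for the letter 0. For words not ending in 0,
  \<open>polylog\<close> is the iterated integral of these forms from 0.\<close>

definition letter_fps :: "complex \<Rightarrow> complex fps" where
  "letter_fps a = (if a = 0 then 1 else Abs_fps (\<lambda>n. if n = 0 then 0 else a ^ n))"

text \<open>The formal integral of \<open>f dX / X\<close>; it drops the constant coefficient because of
  \<open>x / 0 = 0\<close>.\<close>

definition log_integral :: "complex fps \<Rightarrow> complex fps" where
  "log_integral f = Abs_fps (\<lambda>n. f $ n / of_nat n)"

fun polylog :: "complex list \<Rightarrow> complex fps" where
  "polylog [] = 1"
| "polylog (a # w) = log_integral (letter_fps a * polylog w)"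

lemma log_integral_nth [simp]: "log_integral f $ n = f $ n / of_nat n"
  by (simp add: log_integral_def)

lemma log_integral_add: "log_integral (f + g) = log_integral f + log_integral g"
  by (rule fps_ext) (simp add: add_divide_distrib)

lemma X_deriv_log_integral: "f $ 0 = 0 \<Longrightarrow> fps_X * fps_deriv (log_integral f) = f"
  by (rule fps_ext) (simp add: fps_X_mult_nth)

lemma fps_eqI_X_deriv:
  fixes f g :: "complex fps"
  assumes "fps_X * fps_deriv f = fps_X * fps_deriv g" "f $ 0 = g $ 0"
  shows "f = g"
  using assms by (simp add: fps_deriv_eq_iff)

definition polylog_ext :: "(complex list \<Rightarrow>\<^sub>0 rat) \<Rightarrow> complex fps" where
  "polylog_ext p = Abs_fps (\<lambda>n. linear_ext (\<lambda>w. polylog w $ n) p)"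

lemma polylog_ext_add: "polylog_ext (p + q) = polylog_ext p + polylog_ext q"
  by (rule fps_ext) (simp add: polylog_ext_def linear_ext_add)

lemma polylog_ext_word [simp]: "polylog_ext (word w) = polylog w"
  by (rule fps_ext) (simp add: polylog_ext_def)

lemma polylog_ext_prepend:
  "polylog_ext (prepend a p) = log_integral (letter_fps a * polylog_ext p)"
proof (rule fps_ext)
  fix n
  have "linear_ext (\<lambda>w. (\<Sum>i=0..n. letter_fps a $ i * polylog w $ (n - i)) / of_nat n) p =
      (\<Sum>i=0..n. letter_fps a $ i * linear_ext (\<lambda>w. polylog w $ (n - i)) p) / of_nat n"
    using linear_ext_fun_cmult[of "inverse (of_nat n)"]
    by (simp add: divide_inverse_commute linear_ext_fun_sum linear_ext_fun_cmult)
  then show "polylog_ext (prepend a p) $ n = log_integral (letter_fps a * polylog_ext p) $ n"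
    by (simp add: polylog_ext_def linear_ext_prepend fps_mult_nth)
qed

text \<open>Only the one-letter word 0 leaves a constant coefficient, that is a form dX / X that
  cannot be integrated from 0. This is the reason for excluding words that end in 0.\<close>

lemma letter_polylog_nth_0:
  assumes "w = [] \<Longrightarrow> a \<noteq> 0"
  shows "(letter_fps a * polylog w) $ 0 = 0"
  using assms by (cases w) (auto simp: letter_fps_def)

text \<open>The operator \<open>X d/dX\<close> is a derivation that removes the first letter of a polylogarithm, and
  so obeys the recursion of the shuffle product.\<close>

lemma polylog_ext_shuffle_words:
  assumes "u = [] \<or> last u \<noteq> 0" "v = [] \<or> last v \<noteq> 0"
  shows "polylog_ext (shuffle_words u v) = polylog u * polylog v"
  using assms
proof (induction u v rule: shuffle_words.induct)
  case (3 a u b v)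
  let ?f = "letter_fps a * polylog u * polylog (b # v)"
  let ?g = "letter_fps b * polylog v * polylog (a # u)"
  have 0: "(letter_fps a * polylog u) $ 0 = 0" "(letter_fps b * polylog v) $ 0 = 0"
    by (rule letter_polylog_nth_0; use 3 in auto)+
  have IH: "polylog_ext (shuffle_words u (b # v)) = polylog u * polylog (b # v)"
    "polylog_ext (shuffle_words (a # u) v) = polylog (a # u) * polylog v"
    using 3 by (auto split: if_splits)
  have ext: "polylog_ext (shuffle_words (a # u) (b # v)) = log_integral (?f + ?g)"
    unfolding shuffle_words.simps polylog_ext_add polylog_ext_prepend IH log_integral_add
    by (simp only: mult_ac)
  have "fps_X * fps_deriv (polylog (a # u) * polylog (b # v)) =
      (fps_X * fps_deriv (polylog (a # u))) * polylog (b # v) +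
      (fps_X * fps_deriv (polylog (b # v))) * polylog (a # u)"
    by (simp add: algebra_simps del: polylog.simps)
  also have "\<dots> = ?f + ?g"
    unfolding polylog.simps(2) X_deriv_log_integral[OF 0(1)] X_deriv_log_integral[OF 0(2)] ..
  finally have deriv: "fps_X * fps_deriv (polylog (a # u) * polylog (b # v)) = ?f + ?g" .
  have const: "(?f + ?g) $ 0 = 0" using 0 by auto
  show ?case
    unfolding ext
    by (rule fps_eqI_X_deriv) (simp_all only: X_deriv_log_integral[OF const] deriv, simp)
qed simp_all

lemma letter_mult_nth:
  assumes "a \<noteq> 0"
  shows "(letter_fps a * f) $ n = (\<Sum>j<n. a ^ (n - j) * f $ j)"
proof -
  have "(letter_fps a * f) $ n = (\<Sum>j=0..n. f $ j * letter_fps a $ (n - j))"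
    by (simp only: mult.commute[of "letter_fps a"] fps_mult_nth)
  also have "\<dots> = (\<Sum>j<n. f $ j * letter_fps a $ (n - j))"
    by (simp add: letter_fps_def assms atLeast0AtMost lessThan_Suc_atMost[symmetric])
  also have "\<dots> = (\<Sum>j<n. a ^ (n - j) * f $ j)"
    by (intro sum.cong) (auto simp: letter_fps_def assms)
  finally show ?thesis .
qed

text \<open>A nonzero letter sums n coefficients of norm at most 1, and the integration divides by
  n. Hence the series converges absolutely inside the unit disc.\<close>

lemma norm_polylog_nth_le:
  assumes "\<forall>a\<in>set w. norm a = 1 \<or> a = 0"
  shows "norm (polylog w $ n) \<le> 1"
  using assms
proof (induction w arbitrary: n)
  case (Cons a w)
  show ?case
  proof (cases "a = 0")
    case True
    have "norm (polylog w $ n) \<le> 1" using Cons by auto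
    then have "norm (polylog w $ n) / real n \<le> 1" by (cases n) (auto simp: divide_le_eq_1)
    with True show ?thesis by (simp add: letter_fps_def norm_divide)
  next
    case False
    have "norm (\<Sum>j<n. a ^ (n - j) * polylog w $ j) \<le> (\<Sum>j<n. 1)"
      using Cons False by (intro sum_norm_le) (auto simp: norm_mult norm_power)
    then show ?thesis
      by (cases n) (auto simp: letter_mult_nth[OF False] norm_divide divide_le_eq_1 simp del: of_nat_Suc)
  qed
qed simp

text \<open>A recursive form of \<open>color_quotients\<close>: c carries the inverse of the
  preceding color into the next one.\<close>

fun quotients_from :: "complex \<Rightarrow> index \<Rightarrow> index" where
  "quotients_from c [] = []"
| "quotients_from c ((m, \<mu>) # w) = (m, c * \<mu>) # quotients_from (1 / \<mu>) w"

lemma color_quotients_eq: "color_quotients w = quotients_from 1 w"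
proof -
  have "quotients_from c w = map (\<lambda>i. (fst (w ! i),
      if i = 0 then c * snd (w ! i) else snd (w ! i) / snd (w ! (i - 1)))) [0..<length w]" for c
  proof (induction c w rule: quotients_from.induct)
    case (2 c m \<mu> w)
    have "(if i = 0 then 1 / \<mu> * snd (w ! i) else snd (w ! i) / snd (w ! (i - 1))) =
        snd (w ! i) / snd (((m, \<mu>) # w) ! i)" for i
      by (cases i) auto
    then show ?case
      unfolding quotients_from.simps 2 list.size add_0_right add_Suc_right map_upt_Suc by simp
  qed simp
  then show ?thesis by (simp add: color_quotients_def cong: if_cong)
qed

lemma polylog_replicate_0: "polylog (replicate j 0 @ w) $ n = polylog w $ n / of_nat n ^ j"
  by (induction j) (simp_all add: letter_fps_def)

text \<open>Multiplication by the series of a letter \<mu> turns the k-th coefficient into \<mu>^k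
  times a partial sum, at the point 1 / \<mu>, of the series of the remaining word. So the induction
  needs every point c, and quotients of consecutive colors appear.\<close>

lemma sum_polylog_x_word:
  assumes "\<forall>(m, \<mu>)\<in>set w. m \<ge> 1 \<and> \<mu> \<noteq> 0"
  shows "(\<Sum>k\<le>n. c ^ k * polylog (x_word w) $ k) = cmzv_upto (quotients_from c w) n"
  using assms
proof (induction c w arbitrary: n rule: quotients_from.induct)
  case (1 c)
  have "(\<Sum>k\<le>n. c ^ k * polylog (x_word []) $ k) = (\<Sum>k\<le>n. if k = 0 then 1 else 0)"
    by (intro sum.cong) (auto simp: x_word_def)
  then show ?case by simp
next
  case (2 c m \<mu> w)
  then have m: "m \<ge> 1" "\<mu> \<noteq> 0" by auto
  have coeff: "c ^ k * polylog (x_word ((m, \<mu>) # w)) $ k =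
      (c * \<mu>) ^ k / of_nat k ^ m * cmzv_upto (quotients_from (1 / \<mu>) w) (k - 1)" if "k \<ge> 1" for k
  proof -
    have "polylog (x_word ((m, \<mu>) # w)) $ k =
        (\<Sum>j<k. \<mu> ^ (k - j) * polylog (x_word w) $ j) / of_nat k / of_nat k ^ (m - 1)"
      unfolding x_word_def by (simp add: polylog_replicate_0 letter_mult_nth m)
    also have "\<dots> = (\<Sum>j<k. \<mu> ^ (k - j) * polylog (x_word w) $ j) / of_nat k ^ m"
      using m by (cases m) auto
    \<comment> \<open>The strict bound j < k becomes truncation at k - 1, which makes the summation
      indices strictly decreasing.\<close>
    also have "(\<Sum>j<k. \<mu> ^ (k - j) * polylog (x_word w) $ j) =
        \<mu> ^ k * (\<Sum>j\<le>k - 1. (1 / \<mu>) ^ j * polylog (x_word w) $ j)"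
      unfolding sum_distrib_left using m that
      by (intro sum.cong) (auto simp: power_diff power_divide)
    also have "(\<Sum>j\<le>k - 1. (1 / \<mu>) ^ j * polylog (x_word w) $ j) =
        cmzv_upto (quotients_from (1 / \<mu>) w) (k - 1)"
      using 2 by simp
    finally show ?thesis by (simp add: power_mult_distrib)
  qed
  have 0: "polylog (x_word ((m, \<mu>) # w)) $ 0 = 0"
    unfolding x_word_def by (simp add: polylog_replicate_0)
  have "(\<Sum>k\<le>n. c ^ k * polylog (x_word ((m, \<mu>) # w)) $ k) =
      (\<Sum>k=1..n. c ^ k * polylog (x_word ((m, \<mu>) # w)) $ k)"
    by (rule sum.mono_neutral_right) (auto simp: 0 not_less_eq_eq)
  also have "\<dots> = cmzv_upto (quotients_from c ((m, \<mu>) # w)) n"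
    unfolding quotients_from.simps cmzv_upto_Cons by (intro sum.cong refl coeff) auto
  finally show ?case .
qed

section \<open>Values of polylogarithms at points tending to 1\<close>

definition polylog_at :: "real \<Rightarrow> complex list \<Rightarrow> complex" where
  "polylog_at z w = suminf (\<lambda>n. polylog w $ n * of_real z ^ n)"

lemma summable_norm_polylog:
  assumes "\<forall>a\<in>set w. norm a = 1 \<or> a = 0" "0 \<le> z" "z < 1"
  shows "summable (\<lambda>n. norm (polylog w $ n * of_real z ^ n))"
  by (rule summable_comparison_test'[of "\<lambda>n. z ^ n" 0])
    (use assms norm_polylog_nth_le in \<open>auto simp: norm_mult norm_power mult_left_le_one_le\<close>)

lemma polylog_at_Nil: "polylog_at z [] = 1"
proof -
  have "(\<lambda>n. polylog [] $ n * of_real z ^ n) = (\<lambda>n. if n = 0 then 1 else 0)"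
    by auto
  then show ?thesis by (simp add: polylog_at_def suminf_eq_zero_iff sums_unique[OF sums_single, symmetric])
qed

lemma polylog_at_shuffle:
  assumes "\<forall>a\<in>set u \<union> set v. norm a = 1 \<or> a = 0" "0 \<le> z" "z < 1"
    and uv: "u = [] \<or> last u \<noteq> 0" "v = [] \<or> last v \<noteq> 0"
    and keys: "\<forall>w\<in>Poly_Mapping.keys (shuffle_words u v). \<forall>a\<in>set w. norm a = 1 \<or> a = 0"
  shows "linear_ext (polylog_at z) (shuffle_words u v) = polylog_at z u * polylog_at z v"
proof -
  let ?p = "shuffle_words u v"
  have "polylog_at z u * polylog_at z v =
      suminf (\<lambda>n. \<Sum>i\<le>n. (polylog u $ i * of_real z ^ i) * (polylog v $ (n - i) * of_real z ^ (n - i)))"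
    unfolding polylog_at_def using assms(1-3)
    by (intro Cauchy_product summable_norm_polylog) auto
  also have "(\<lambda>n. \<Sum>i\<le>n. (polylog u $ i * of_real z ^ i) * (polylog v $ (n - i) * of_real z ^ (n - i)))
      = (\<lambda>n. (polylog u * polylog v) $ n * of_real z ^ n)"
  proof
    fix n
    have "(polylog u $ i * of_real z ^ i) * (polylog v $ (n - i) * of_real z ^ (n - i)) =
        polylog u $ i * polylog v $ (n - i) * of_real z ^ n" if "i \<le> n" for i
    proof -
      have "of_real z ^ n = (of_real z ^ i * of_real z ^ (n - i) :: complex)"
        using that by (simp flip: power_add)
      then show ?thesis by (simp add: mult_ac)
    qed
    then show "(\<Sum>i\<le>n. (polylog u $ i * of_real z ^ i) * (polylog v $ (n - i) * of_real z ^ (n - i)))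
        = (polylog u * polylog v) $ n * of_real z ^ n"
      unfolding fps_mult_nth atLeast0AtMost sum_distrib_right by (intro sum.cong) auto
  qed
  also have "(\<lambda>n. (polylog u * polylog v) $ n * of_real z ^ n) =
      (\<lambda>n. \<Sum>w\<in>Poly_Mapping.keys ?p.
        of_rat (Poly_Mapping.lookup ?p w) * (polylog w $ n * of_real z ^ n))"
    unfolding polylog_ext_shuffle_words[OF uv, symmetric] polylog_ext_def linear_ext_def
    by (simp add: sum_distrib_left mult_ac)
  also have "suminf \<dots> = (\<Sum>w\<in>Poly_Mapping.keys ?p.
      suminf (\<lambda>n. of_rat (Poly_Mapping.lookup ?p w) * (polylog w $ n * of_real z ^ n)))"
    using keys assms(2,3)
    by (intro suminf_sum summable_mult summable_norm_cancel[OF summable_norm_polylog]) auto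
  also have "\<dots> = linear_ext (polylog_at z) ?p"
    unfolding linear_ext_def polylog_at_def using keys assms(2,3)
    by (intro sum.cong refl suminf_mult summable_norm_cancel[OF summable_norm_polylog]) auto
  finally show ?thesis ..
qed

text \<open>Since 1 - z = 1 / (M + 1) at this point z, the divergent value -ln (1 - z) becomes
  \<open>ln (M + 1)\<close>, and \<open>log_growth\<close> serves as in the stuffle case.\<close>

definition node :: "nat \<Rightarrow> real" where
  "node M = 1 - 1 / (real M + 1)"

lemma node_bounds: "0 \<le> node M" "node M < 1"
  by (auto simp: node_def)

lemma sums_node: "(\<lambda>n. node M ^ n / real n) sums ln (real M + 1)"
proof -
  have "(\<lambda>n. - ((- (- node M)) ^ n) / real n) sums ln (1 + - node M)"
    using node_bounds[of M] by (intro ln_series') auto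
  then have "(\<lambda>n. - (- (node M ^ n) / real n)) sums - ln (1 - node M)"
    by (intro sums_minus) simp
  moreover have "- ln (1 - node M) = ln (real M + 1)"
    by (simp add: node_def ln_div)
  ultimately show ?thesis by simp
qed

lemma polylog_at_node_1: "polylog_at (node M) [1] = of_real (ln (real M + 1))"
proof -
  have sums: "(\<lambda>n. of_real (node M ^ n / real n)) sums (of_real (ln (real M + 1)) :: complex)"
    using sums_node by (rule sums_of_real)
  have eq: "(\<lambda>n. polylog [1] $ n * of_real (node M) ^ n) =
      (\<lambda>n. of_real (node M ^ n / real n))"
    by (simp add: letter_fps_def fun_eq_iff)
  show ?thesis unfolding polylog_at_def eq by (rule sums_unique[OF sums, symmetric])
qed

text \<open>A quantitative form of Abel's limit theorem.\<close>

lemma polylog_at_node_rate: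
  assumes w: "\<forall>a\<in>set w. norm a = 1 \<or> a = 0"
    and D: "D \<ge> 0" "\<And>n. norm ((\<Sum>k\<le>n. polylog w $ k) - l) \<le> D / sqrt (real n + 1)"
  shows "norm (polylog_at (node M) w - l) \<le> 2 * D * log_growth M / sqrt (real M + 1)"
proof -
  let ?S = "\<lambda>n. \<Sum>k\<le>n. polylog w $ k"
  define z where "z = node M"
  define r where "r = sqrt (real M + 1)"
  have r: "r > 0" "r * r = real M + 1" by (auto simp: r_def)
  have z: "0 \<le> z" "z < 1" "1 - z = 1 / (r * r)" using node_bounds r by (auto simp: z_def node_def)
  \<comment> \<open>The Cauchy product with the geometric series replaces coefficients by partial
    sums: the sum of \<open>?S n * z ^ n\<close> is the polylogarithm divided by 1 - z.\<close>
  have "(\<lambda>n. \<Sum>i\<le>n. (polylog w $ i * of_real z ^ i) * of_real z ^ (n - i)) sums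
      (polylog_at z w * suminf (\<lambda>n. of_real z ^ n))"
    unfolding polylog_at_def using z w
    by (intro Cauchy_product_sums summable_norm_polylog) (auto simp: norm_power)
  moreover have "(\<Sum>i\<le>n. (polylog w $ i * of_real z ^ i) * of_real z ^ (n - i)) = ?S n * of_real z ^ n"
    for n
    unfolding sum_distrib_right by (intro sum.cong) (auto simp: mult.assoc simp flip: power_add)
  moreover have geo: "(\<lambda>n. of_real z ^ n) sums (1 / (1 - of_real z) :: complex)"
    using z by (intro geometric_sums) auto
  ultimately have "(\<lambda>n. ?S n * of_real z ^ n) sums (polylog_at z w * (1 / (1 - of_real z)))"
    by (simp add: sums_iff)
  from sums_diff[OF this sums_mult[OF geo, of l]]
  have diff: "(\<lambda>n. (?S n - l) * of_real z ^ n) sums ((polylog_at z w - l) / (1 - of_real z))"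
    by (simp add: algebra_simps diff_divide_distrib)
  \<comment> \<open>With t = \<open>sqrt (n + 1)\<close>, comparing t and r gives 1 / t \<le> 1 / r
    + r / t^2. The two parts sum to a geometric and a logarithmic series; the last summand makes up
    for \<open>z ^ 0 / real 0 = 0\<close>.\<close>
  define b where "b n = D * (1 / r * z ^ n + r * (z ^ n / real n + (if n = 0 then 1 else 0)))" for n
  have b_sums: "b sums (D * (1 / r * (1 / (1 - z)) + r * (ln (real M + 1) + 1)))"
    unfolding b_def using z
    by (intro sums_mult sums_add geometric_sums) (auto simp: z_def sums_node sums_single[of 0 "\<lambda>_. 1", simplified])
  have "norm ((?S n - l) * of_real z ^ n) \<le> b n" for n
  proof -
    define t where "t = sqrt (real n + 1)"
    have t: "t > 0" "t * t = real n + 1" by (auto simp: t_def)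
    have "1 / t \<le> 1 / r + r / (t * t)"
    proof (cases "r \<le> t")
      case True
      then have "1 / t \<le> 1 / r" using r by (intro frac_le) auto
      then show ?thesis using r t by (smt (verit) divide_nonneg_pos mult_pos_pos)
    next
      case False
      then have "t / (t * t) \<le> r / (t * t)" using t by (intro divide_right_mono) auto
      moreover have "t / (t * t) = 1 / t" using t(1) by simp
      moreover have "1 / r \<ge> 0" using r by simp
      ultimately show ?thesis by linarith
    qed
    then have "z ^ n * (1 / t) \<le> z ^ n * (1 / r + r / (t * t))"
      using z by (intro mult_left_mono) auto
    also have "\<dots> = 1 / r * z ^ n + r * (z ^ n / (real n + 1))"
      unfolding t(2) by (simp add: field_simps)
    also have "z ^ n / (real n + 1) \<le> z ^ n / real n + (if n = 0 then 1 else 0)"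
      using z by (cases n) (auto intro!: frac_le)
    finally have "z ^ n * (1 / t) \<le> 1 / r * z ^ n + r * (z ^ n / real n + (if n = 0 then 1 else 0))"
      using r by (simp add: mult_left_mono)
    then have "D * (z ^ n * (1 / t)) \<le> b n" unfolding b_def using D by (intro mult_left_mono)
    moreover have "norm ((?S n - l) * of_real z ^ n) \<le> D / t * z ^ n"
      using mult_right_mono[OF D(2)[of n], of "z ^ n"] z by (simp add: norm_mult norm_power t_def)
    ultimately show ?thesis by (simp add: mult_ac)
  qed
  then have "norm ((polylog_at z w - l) / (1 - of_real z)) \<le>
      D * (1 / r * (1 / (1 - z)) + r * (ln (real M + 1) + 1))"
    using norm_suminf_le[of "\<lambda>n. (?S n - l) * of_real z ^ n" b] diff b_sums by (auto simp: sums_iff)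
  also have "norm ((polylog_at z w - l) / (1 - of_real z)) = norm (polylog_at z w - l) * (r * r)"
  proof -
    have "1 - complex_of_real z = of_real (1 / (r * r))" by (simp flip: z(3))
    then show ?thesis using r(1) by (simp add: norm_divide norm_mult)
  qed
  also have "D * (1 / r * (1 / (1 - z)) + r * (ln (real M + 1) + 1)) = D * r * (1 + log_growth M)"
  proof -
    have "1 / r * (1 / (1 / (r * r))) = r" using r(1) by simp
    then show ?thesis unfolding z(3) log_growth_def by (simp only:) (simp add: algebra_simps)
  qed
  also have "\<dots> \<le> D * r * (2 * log_growth M)"
    using D r log_growth_ge_1[of M] by (intro mult_left_mono) auto
  also have "\<dots> = (2 * D * log_growth M / r) * (r * r)" using r(1) by simp
  finally have "norm (polylog_at z w - l) * (r * r) \<le> (2 * D * log_growth M / r) * (r * r)" .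
  then have "norm (polylog_at z w - l) \<le> 2 * D * log_growth M / r"
    by (rule mult_right_le_imp_le) (use r in auto)
  then show ?thesis by (simp add: z_def r_def)
qed

subsection \<open>Existence of the regularized homomorphisms\<close>

lemma norm_root_of_unity:
  assumes "1 \<le> N" "z \<in> roots_of_unity N"
  shows "norm z = 1"
proof -
  have "norm z ^ N = 1 ^ N" using assms by (simp add: roots_of_unity_def flip: norm_power)
  then show ?thesis using assms(1) power_eq_iff_eq_base[of N "norm z" 1] by simp
qed

lemma one_root_of_unity [simp]: "1 \<in> roots_of_unity N"
  by (simp add: roots_of_unity_def)

lemma mult_root_of_unity:
  "x \<in> roots_of_unity N \<Longrightarrow> y \<in> roots_of_unity N \<Longrightarrow> x * y \<in> roots_of_unity N"
  by (simp add: roots_of_unity_def power_mult_distrib)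

lemma cnj_root_of_unity: "x \<in> roots_of_unity N \<Longrightarrow> cnj x \<in> roots_of_unity N"
  by (simp add: roots_of_unity_def flip: complex_cnj_power)

lemma prepend_in_span_words:
  assumes "p \<in> span_words V" "\<And>w. w \<in> V \<Longrightarrow> a # w \<in> W"
  shows "prepend a p \<in> span_words W"
  using assms by (auto simp: span_words_def keys_prepend)

section \<open>Words in the letters y and the stuffle case\<close>

lemma y_words_Cons:
  "(m, \<mu>) # w \<in> y_words N \<longleftrightarrow> 1 \<le> m \<and> \<mu> \<in> roots_of_unity N \<and> w \<in> y_words N"
  by (auto simp: y_words_def)

lemma unimodular_y_words: "1 \<le> N \<Longrightarrow> w \<in> y_words N \<Longrightarrow> unimodular w"
  using norm_root_of_unity by (fastforce simp: y_words_def unimodular_def)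

lemma stuffle_words_in:
  "u \<in> y_words N \<Longrightarrow> v \<in> y_words N \<Longrightarrow> stuffle_words u v \<in> span_words (y_words N)"
proof (induction u v rule: stuffle_words.induct)
  case (3 m \<mu> u n \<nu> v)
  then have IH: "stuffle_words u ((n, \<nu>) # v) \<in> span_words (y_words N)"
    "stuffle_words ((m, \<mu>) # u) v \<in> span_words (y_words N)"
    "stuffle_words u v \<in> span_words (y_words N)"
    by (auto simp: y_words_Cons)
  show ?case
    unfolding stuffle_words.simps
    by (intro span_words_add prepend_in_span_words[OF IH(1)] prepend_in_span_words[OF IH(2)]
        prepend_in_span_words[OF IH(3)]) (use 3 in \<open>auto simp: y_words_Cons mult_root_of_unity\<close>)
qed auto

text \<open>A generator of weight at least 2 begins with the letter 0, so only \<open>(1, 1)\<close>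
  produces a leading 1.\<close>

lemma y_words0_iff:
  assumes "1 \<le> N" "w \<in> y_words N"
  shows "w \<in> y_words0 N \<longleftrightarrow> w = [] \<or> hd w \<noteq> (1, 1)"
proof (cases w)
  case (Cons a v)
  obtain m \<mu> where "a = (m, \<mu>)" by (cases a)
  then show ?thesis
    using assms Cons by (cases "m - 1") (auto simp: y_words0_def x_word_def y_words_Cons)
qed (use assms in \<open>simp add: y_words0_def x_word_def\<close>)

text \<open>Merging \<open>(1, 1)\<close> with a letter of weight m gives weight m + 1 \<ge> 2, so
  the merged term never begins with \<open>(1, 1)\<close>. The divergent value is the harmonic
  sum.\<close>

lemma regularization_stuffle:
  assumes N: "1 \<le> N"
  shows "regularization (y_words N) (1, 1) stuffle_words (\<lambda>n w. cmzv_upto w n) cmzv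
    (\<lambda>b v. prepend (1 + fst b, 1 * snd b) (word v))"
proof
  have harm: "cmzv_upto [(1, 1)] n = of_real (harm n)" for n
    by (simp add: cmzv_upto_Cons harm_def inverse_eq_divide)
  show "filterlim (\<lambda>n. cmzv_upto [(1, 1)] n) at_infinity sequentially"
    unfolding harm using harm_at_top by (simp add: filterlim_at_infinity_conv_norm_at_top)
  fix w assume w: "w \<in> y_words N" "w = [] \<or> hd w \<noteq> (1, 1)"
  obtain D where D: "D \<ge> 0" "\<And>n. norm (cmzv_upto w n - cmzv w) \<le> D / sqrt (real n + 1)"
    using cmzv_convergence_rate[OF unimodular_y_words[OF N w(1)] w(2)] by blast
  show "negligible_wrt (\<lambda>n. cmzv_upto [(1, 1)] n) (\<lambda>n. cmzv_upto w n - cmzv w)"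
  proof (rule negligible_wrt_log_growth)
    show "norm (cmzv_upto [(1, 1)] n) \<le> log_growth n" for n
      unfolding harm by (simp add: harm_le_log_growth)
    have "D * 1 \<le> D * log_growth n" for n
      using D(1) log_growth_ge_1 by (intro mult_left_mono)
    then have "D / sqrt (real n + 1) \<le> D * log_growth n / sqrt (real n + 1)" for n
      by (intro divide_right_mono) auto
    then show "norm (cmzv_upto w n - cmzv w) \<le> D * log_growth n / sqrt (real n + 1)" for n
      using D(2) order_trans by blast
  qed
next
  fix b :: "nat \<times> complex" and v
  assume bv: "b # v \<in> y_words N"
  obtain m \<mu> where b: "b = (m, \<mu>)" by (cases b)
  then have v: "m \<ge> 1" "\<mu> \<in> roots_of_unity N" "v \<in> y_words N" using bv by (auto simp: y_words_Cons)
  then show "v \<in> y_words N" by simp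
  show "stuffle_words [(1, 1)] (b # v) =
      word ((1, 1) # b # v) + prepend b (stuffle_words [(1, 1)] v) +
      prepend (1 + fst b, 1 * snd b) (word v)"
    by (simp add: b prepend_word)
  have "[(1, 1)] \<in> y_words N" by (simp add: y_words_Cons) (simp add: y_words_def)
  then show "prepend b (stuffle_words [(1, 1)] v) \<in> span_words (y_words N)"
    by (intro prepend_in_span_words[OF stuffle_words_in]) (use v in \<open>auto simp: b y_words_Cons\<close>)
  show "prepend (1 + fst b, 1 * snd b) (word v)
      \<in> span_words {w \<in> y_words N. w = [] \<or> hd w \<noteq> (1, 1)}"
    using v by (simp add: b prepend_word y_words_Cons)
qed (auto simp: y_words_Cons stuffle_words_in linear_ext_stuffle_words, auto simp: y_words_def)

section \<open>Words in the letters x and the shuffle case\<close>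

definition x_words :: "nat \<Rightarrow> complex list set" where
  "x_words N = {w \<in> lists (roots_of_unity N \<union> {0}). w = [] \<or> last w \<noteq> 0}"

text \<open>The length is tracked to ensure that letters are prepended to nonempty words; the letter
  0 in front of the empty word would leave \<open>x_words N\<close>.\<close>

lemma shuffle_words_in:
  assumes "u \<in> x_words N" "v \<in> x_words N"
  shows "shuffle_words u v \<in> span_words {w \<in> x_words N. length w = length u + length v}"
  using assms
proof (induction u v rule: shuffle_words.induct)
  case (3 a u b v)
  then have IH:
    "shuffle_words u (b # v) \<in> span_words {w \<in> x_words N. length w = length u + length (b # v)}"
    "shuffle_words (a # u) v \<in> span_words {w \<in> x_words N. length w = length (a # u) + length v}"
    by (auto simp: x_words_def split: if_splits)
  show ?case
    unfolding shuffle_words.simps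
    by (intro span_words_add prepend_in_span_words[OF IH(1)] prepend_in_span_words[OF IH(2)])
      (use 3 in \<open>auto simp: x_words_def\<close>)
qed (auto simp: x_words_def)

lemma x_word_in: "1 \<le> N \<Longrightarrow> w \<in> y_words N \<Longrightarrow> x_word w \<in> x_words N"
proof (induction w)
  case (Cons a w)
  obtain m \<mu> where "a = (m, \<mu>)" by (cases a)
  moreover from this have "\<mu> \<noteq> 0" using norm_root_of_unity[of N \<mu>] Cons.prems by (auto simp: y_words_Cons)
  ultimately show ?case
    using Cons by (auto simp: x_words_def x_word_def y_words_Cons)
qed (simp add: x_words_def x_word_def)

lemma x_word_surj: "w \<in> x_words N \<Longrightarrow> \<exists>y\<in>y_words N. w = x_word y"
proof (induction w)
  case Nil
  then show ?case by (intro bexI[of _ "[]"]) (auto simp: x_word_def y_words_def)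
next
  case (Cons a w)
  show ?case
  proof (cases "w = []")
    case True
    then show ?thesis using Cons.prems
      by (intro bexI[of _ "[(1, a)]"]) (auto simp: x_word_def y_words_def x_words_def)
  next
    case False
    then obtain y where y: "y \<in> y_words N" "w = x_word y"
      using Cons by (auto simp: x_words_def)
    then obtain m \<mu> y' where y': "y = (m, \<mu>) # y'" using False by (cases y) (auto simp: x_word_def)
    show ?thesis
    proof (cases "a = 0")
      case True
      then have "a # w = x_word ((Suc m, \<mu>) # y')"
        using y y' by (cases m) (auto simp: x_word_def y_words_Cons)
      then show ?thesis using y y' by (intro bexI[of _ "(Suc m, \<mu>) # y'"]) (auto simp: y_words_Cons)
    next
      case False
      then have "a \<in> roots_of_unity N" using Cons.prems by (auto simp: x_words_def)
      moreover have "a # w = x_word ((1, a) # y)" using y by (simp add: x_word_def)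
      ultimately show ?thesis using y
        by (intro bexI[of _ "(1, a) # y"]) (auto simp: y_words_Cons)
    qed
  qed
qed

text \<open>The convergent values as a function of words in the letters x, as the locale requires,
  whereas \<open>color_quotients\<close> works in the other alphabet.\<close>

definition polylog_limit :: "complex list \<Rightarrow> complex" where
  "polylog_limit w = lim (\<lambda>n. \<Sum>k\<le>n. polylog w $ k)"

lemma sum_polylog_eq_cmzv_upto:
  assumes "1 \<le> N" "w \<in> y_words N"
  shows "(\<Sum>k\<le>n. polylog (x_word w) $ k) = cmzv_upto (color_quotients w) n"
proof -
  have "\<forall>(m, \<mu>)\<in>set w. m \<ge> 1 \<and> \<mu> \<noteq> 0"
    using unimodular_y_words[OF assms] by (auto simp: unimodular_def)
  from sum_polylog_x_word[OF this, of 1 n] show ?thesis by (simp add: color_quotients_eq)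
qed

lemma polylog_limit_x_word:
  "1 \<le> N \<Longrightarrow> w \<in> y_words N \<Longrightarrow> polylog_limit (x_word w) = cmzv (color_quotients w)"
  by (simp add: polylog_limit_def sum_polylog_eq_cmzv_upto cmzv_def)

lemma unimodular_Cons:
  "unimodular ((s, \<eta>) # w) \<longleftrightarrow> s \<ge> 1 \<and> norm \<eta> = 1 \<and> unimodular w"
  by (auto simp: unimodular_def)

lemma unimodular_quotients_from:
  "unimodular w \<Longrightarrow> norm c = 1 \<Longrightarrow> unimodular (quotients_from c w)"
  by (induction c w rule: quotients_from.induct)
    (force simp: unimodular_Cons norm_mult norm_divide)+

text \<open>No letters merge in the shuffle product, hence the zero function as last argument. The
  divergent value at the n-th node is \<open>ln (n + 1)\<close>.\<close>

lemma regularization_shuffle: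
  assumes N: "1 \<le> N"
  shows "regularization (x_words N) 1 shuffle_words (\<lambda>n. polylog_at (node n)) polylog_limit
    (\<lambda>b v. 0)"
proof
  have letters: "\<forall>a\<in>set w. norm a = 1 \<or> a = 0" if "w \<in> x_words N" for w
    using that norm_root_of_unity[OF N] by (auto simp: x_words_def)
  have keys: "w \<in> x_words N" if "w \<in> Poly_Mapping.keys (shuffle_words u v)"
    "u \<in> x_words N" "v \<in> x_words N" for u v w
    using shuffle_words_in[OF that(2,3)] that(1) by (auto simp: span_words_def)
  show "filterlim (\<lambda>n. polylog_at (node n) [1]) at_infinity sequentially"
  proof -
    have "filterlim (\<lambda>n. ln (1 + real n)) at_top sequentially"
      by (intro filterlim_compose[OF ln_at_top] filterlim_tendsto_add_at_top[OF tendsto_const]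
          filterlim_real_sequentially)
    then show ?thesis
      by (simp add: polylog_at_node_1 filterlim_at_infinity_conv_norm_at_top add.commute)
  qed
  fix w assume w: "w \<in> x_words N" "w = [] \<or> hd w \<noteq> 1"
  obtain y where y: "y \<in> y_words N" "w = x_word y" using x_word_surj[OF w(1)] by blast
  have "unimodular (color_quotients y)"
    unfolding color_quotients_eq
    by (intro unimodular_quotients_from unimodular_y_words[OF N] y) simp
  \<comment> \<open>The passage to quotients keeps the first letter, so a word without leading 1
    yields a convergent index.\<close>
  moreover have "color_quotients y = [] \<or> hd (color_quotients y) \<noteq> (1, 1)"
  proof (cases y)
    case (Cons a v)
    then show ?thesis using w(2) y(2) by (cases a) (auto simp: color_quotients_eq x_word_def)
  qed (simp add: color_quotients_def)
  ultimately obtain D where D: "D \<ge> 0"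
    "\<And>n. norm (cmzv_upto (color_quotients y) n - cmzv (color_quotients y)) \<le> D / sqrt (real n + 1)"
    using cmzv_convergence_rate by blast
  show "negligible_wrt (\<lambda>n. polylog_at (node n) [1])
      (\<lambda>n. polylog_at (node n) w - polylog_limit w)"
  proof (rule negligible_wrt_log_growth)
    show "norm (polylog_at (node n) [1]) \<le> log_growth n" for n
      by (simp add: polylog_at_node_1 log_growth_def)
    show "norm (polylog_at (node n) w - polylog_limit w) \<le>
        2 * D * log_growth n / sqrt (real n + 1)" for n
      using D by (intro polylog_at_node_rate letters w)
        (simp_all add: y polylog_limit_x_word[OF N] sum_polylog_eq_cmzv_upto[OF N])
  qed
next
  fix u v assume uv: "u \<in> x_words N" "v \<in> x_words N"
  then show "shuffle_words u v \<in> span_words (x_words N)"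
    using shuffle_words_in[OF uv] by (auto simp: span_words_def)
  fix n
  show "linear_ext (polylog_at (node n)) (shuffle_words u v) =
      polylog_at (node n) u * polylog_at (node n) v"
    using uv norm_root_of_unity[OF N] node_bounds shuffle_words_in[OF uv]
    by (intro polylog_at_shuffle) (fastforce simp: x_words_def span_words_def)+
next
  fix b v assume bv: "b # v \<in> x_words N"
  then have v: "v \<in> x_words N" by (auto simp: x_words_def split: if_splits)
  then show "v \<in> x_words N" .
  show "shuffle_words [1] (b # v) = word (1 # b # v) + prepend b (shuffle_words [1] v) + 0"
    by (simp add: prepend_word)
  have "[1] \<in> x_words N" by (simp add: x_words_def)
  from shuffle_words_in[OF this v] show "prepend b (shuffle_words [1] v) \<in> span_words (x_words N)"
    by (rule prepend_in_span_words) (use bv in \<open>auto simp: x_words_def\<close>)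
qed (auto simp: x_words_def polylog_at_Nil span_words_def)

subsection \<open>Independence of the variable\<close>

lemma pderiv_zeta_stuffle:
  assumes N: "1 \<le> N" and w: "w \<in> y_words N"
  shows "pderiv (zeta_stuffle_hom N (word ((1, 1) # w))) = zeta_stuffle_hom N (word w)"
    and "w = [] \<or> hd w \<noteq> (1, 1) \<Longrightarrow> pderiv (zeta_stuffle_hom N (word w)) = 0"
proof -
  interpret regularization "y_words N" "(1, 1)" stuffle_words "\<lambda>n w. cmzv_upto w n" cmzv
    "\<lambda>b v. prepend (1 + fst b, 1 * snd b) (word v)"
    by (rule regularization_stuffle[OF N])
  have "v \<in> W0 \<longleftrightarrow> v \<in> y_words0 N" for v
    unfolding W0_def using y_words0_iff[OF N, of v]
    by (cases "v \<in> y_words N") (auto simp: y_words0_def)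
  then have "W0 = y_words0 N" by blast
  then have "zeta_stuffle_hom N = (THE Z. regularized Z)"
    unfolding zeta_stuffle_hom_def regularized_def A1_y_def stuffle_def by simp
  then have Z: "regularized (zeta_stuffle_hom N)" using regularized_the by simp
  show "pderiv (zeta_stuffle_hom N (word ((1, 1) # w))) = zeta_stuffle_hom N (word w)"
    by (rule pderiv_regularized[OF Z w])
  show "pderiv (zeta_stuffle_hom N (word w)) = 0" if "w = [] \<or> hd w \<noteq> (1, 1)"
    by (rule pderiv_regularized_convergent[OF Z w that])
qed

lemma pderiv_zeta_shuffle:
  assumes N: "1 \<le> N" and w: "w \<in> y_words N"
  shows "pderiv (zeta_shuffle_hom N (word (x_word ((1, 1) # w)))) = zeta_shuffle_hom N (word (x_word w))"
    and "w = [] \<or> hd w \<noteq> (1, 1) \<Longrightarrow> pderiv (zeta_shuffle_hom N (word (x_word w))) = 0"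
proof -
  interpret regularization "x_words N" 1 shuffle_words "\<lambda>n. polylog_at (node n)" polylog_limit
    "\<lambda>b v. 0"
    by (rule regularization_shuffle[OF N])
  \<comment> \<open>The locale quantifies over words in the letters x and
    \<open>zeta_shuffle_hom\<close> over words in the letters y; \<open>x_word\<close> matches the
    two.\<close>
  have "W0 = x_word ` y_words0 N"
  proof (intro equalityI subsetI)
    fix v assume v: "v \<in> W0"
    then obtain y where "y \<in> y_words N" "v = x_word y" using x_word_surj by (auto simp: W0_def)
    with v show "v \<in> x_word ` y_words0 N" by (auto simp: W0_def y_words0_def)
  qed (use x_word_in[OF N] in \<open>auto simp: W0_def y_words0_def\<close>)
  then have "(\<forall>v\<in>W0. Z (word v) = [:polylog_limit v:]) \<longleftrightarrow>
      (\<forall>y\<in>y_words0 N. Z (word (x_word y)) = [:cmzv (color_quotients y):])"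
    for Z :: "_ \<Rightarrow> complex poly"
    using polylog_limit_x_word[OF N] by (auto simp: y_words0_def)
  then have "zeta_shuffle_hom N = (THE Z. regularized Z)"
    unfolding zeta_shuffle_hom_def regularized_def A1_x_def shuffle_def x_words_def[symmetric]
    by simp
  then have Z: "regularized (zeta_shuffle_hom N)" using regularized_the by simp
  have "x_word ((1, 1) # w) = 1 # x_word w" by (simp add: x_word_def)
  then show "pderiv (zeta_shuffle_hom N (word (x_word ((1, 1) # w)))) =
      zeta_shuffle_hom N (word (x_word w))"
    using pderiv_regularized[OF Z x_word_in[OF N w]] by simp
  show "pderiv (zeta_shuffle_hom N (word (x_word w))) = 0" if "w = [] \<or> hd w \<noteq> (1, 1)"
    using y_words0_iff[OF N w] that
    by (intro pderiv_regularized_convergent[OF Z x_word_in[OF N w]]) (auto simp: y_words0_def)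
qed

lemma color_products_Nil [simp]: "color_products [] = []"
  by (simp add: color_products_def)

text \<open>A leading color 1 does not affect the later products, so deleting the letter
  \<open>(1, 1)\<close> commutes with \<open>color_products\<close>.\<close>

lemma color_products_one_Cons: "color_products ((m, 1) # w) = (m, 1) # color_products w"
  unfolding color_products_def list.size add_0_right add_Suc_right map_upt_Suc
  by (simp add: prod.atMost_Suc_shift del: prod.atMost_Suc)

lemma hd_color_products: "hd (color_products (a # w)) = a"
  unfolding color_products_def list.size add_0_right add_Suc_right map_upt_Suc by simp

lemma color_products_in:
  assumes "w \<in> y_words N"
  shows "color_products w \<in> y_words N"
proof -
  have "(\<Prod>j\<le>i. snd (w ! j)) \<in> roots_of_unity N \<and> 1 \<le> fst (w ! i)" if "i < length w" for i
  proof -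
    have nth: "1 \<le> fst (w ! j) \<and> snd (w ! j) \<in> roots_of_unity N" if "j < length w" for j
      using assms that unfolding y_words_def by (metis in_listsD mem_Sigma_iff nth_mem
          mem_Collect_eq prod.collapse)
    then have "(\<Prod>j\<le>i. snd (w ! j)) ^ N = 1"
      unfolding prod_power_distrib using that
      by (intro prod.neutral) (auto simp: roots_of_unity_def)
    then show ?thesis using nth that by (simp add: roots_of_unity_def)
  qed
  then show ?thesis by (auto simp: y_words_def color_products_def)
qed

text \<open>The derivative of the \<open>j\<close>-th term is a sum of two parts, and the part from its second
  factor cancels against the part of the \<open>(j + 1)\<close>-st term from its first factor.\<close>

lemma pderiv_symmetrized:
  assumes len: "length s = length \<eta>"
    and s\<eta>: "\<forall>m\<in>set s. 1 \<le> m" "set \<eta> \<subseteq> roots_of_unity N"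
    and lead: "\<And>s \<eta>. length s = length \<eta> \<Longrightarrow> zip s \<eta> \<in> y_words N \<Longrightarrow>
      pderiv (Z (1 # s) (1 # \<eta>)) = Z s \<eta>"
    and const: "\<And>s \<eta>. length s = length \<eta> \<Longrightarrow> zip s \<eta> \<in> y_words N \<Longrightarrow>
      s = [] \<or> (hd s, hd \<eta>) \<noteq> (1, 1) \<Longrightarrow> pderiv (Z s \<eta>) = 0"
  shows "pderiv (symmetrized Z s \<eta>) = 0"
proof -
  define d where "d = length s"
  define c where "c j = (- 1) ^ sum_list (take j s) * prod_list (map cnj (take j \<eta>))" for j
  define R where "R j = Z (rev (take j s)) (rev (map cnj (take j \<eta>)))" for j
  define Q where "Q j = Z (drop j s) (drop j \<eta>)" for j
  define A where "A j = smult (c j) (pderiv (R j) * Q j)" for j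
  define B where "B j = smult (c j) (R j * pderiv (Q j))" for j
  have valid: "zip s' \<eta>' \<in> y_words N" if "set s' \<subseteq> set s" "set \<eta>' \<subseteq> roots_of_unity N" for s' \<eta>'
    using that s\<eta>(1) unfolding y_words_def by (auto dest: set_zip_leftD set_zip_rightD)
  have valid_R: "zip (rev (take j s)) (rev (map cnj (take j \<eta>))) \<in> y_words N" for j
    using s\<eta>(2) by (intro valid) (auto intro!: cnj_root_of_unity dest: in_set_takeD)
  have valid_Q: "zip (drop j s) (drop j \<eta>) \<in> y_words N" for j
    using s\<eta>(2) by (intro valid) (auto dest: in_set_dropD)
  have cancel: "A (Suc j) + B j = 0" if "j < d" for j
  proof -
    have j: "j < length s" "j < length \<eta>" using that len by (auto simp: d_def)
    \<comment> \<open>The reversal brings the letter at position j, with conjugated color, to the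
      front of \<open>R (Suc j)\<close>; the same letter stands in front of
      \<open>Q j\<close>.\<close>
    have R: "R (Suc j) = Z (s ! j # rev (take j s)) (cnj (\<eta> ! j) # rev (map cnj (take j \<eta>)))"
      using j by (simp add: R_def take_Suc_conv_app_nth)
    have Q: "Q j = Z (s ! j # drop (Suc j) s) (\<eta> ! j # drop (Suc j) \<eta>)"
      using j by (simp add: Q_def Cons_nth_drop_Suc)
    show ?thesis
    proof (cases "s ! j = 1 \<and> \<eta> ! j = 1")
      case True
      \<comment> \<open>Weight 1 contributes the sign and color 1 a trivial factor.\<close>
      then have "c (Suc j) = - c j" using j by (simp add: c_def take_Suc_conv_app_nth)
      moreover have "pderiv (R (Suc j)) = R j"
        using lead[OF _ valid_R[of j]] len True by (simp add: R) (simp add: R_def)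
      moreover have "pderiv (Q j) = Q (Suc j)"
        using lead[OF _ valid_Q[of "Suc j"]] len True by (simp add: Q) (simp add: Q_def)
      ultimately show ?thesis by (simp add: A_def B_def)
    next
      case False
      \<comment> \<open>A color is 1 exactly if its conjugate is, so neither factor begins with
        \<open>(1, 1)\<close> and both derivatives vanish.\<close>
      then have "s ! j = 1 \<Longrightarrow> cnj (\<eta> ! j) \<noteq> 1" by (metis complex_cnj_cnj complex_cnj_one)
      then have "pderiv (R (Suc j)) = 0"
        using const[OF _ valid_R[of "Suc j"]] len j
        by (auto simp: R_def take_Suc_conv_app_nth)
      moreover have "pderiv (Q j) = 0"
        using const[OF _ valid_Q[of j]] len j False
        by (auto simp: Q_def hd_drop_conv_nth)
      ultimately show ?thesis by (simp add: A_def B_def)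
    qed
  qed
  \<comment> \<open>At either end one factor belongs to the empty index and is constant, so no
    boundary term survives.\<close>
  have 0: "A 0 = 0" using const[of "[]" "[]"] by (simp add: A_def R_def y_words_def)
  have "B d = 0" using const[of "[]" "[]"] len by (simp add: B_def Q_def d_def y_words_def)
  have "pderiv (symmetrized Z s \<eta>) = (\<Sum>j\<le>d. A j + B j)"
    unfolding symmetrized_def
    by (simp add: higher_pderiv_sum[of 1, simplified] pderiv_smult pderiv_mult A_def B_def c_def R_def Q_def d_def
        atLeast0AtMost smult_add_right algebra_simps)
  also have "\<dots> = (\<Sum>j<d. A (Suc j)) + (\<Sum>j<d. B j)"
    unfolding sum.distrib sum.atMost_shift[of A]
    by (simp add: 0 \<open>B d = 0\<close> flip: lessThan_Suc_atMost)
  also have "\<dots> = (\<Sum>j<d. A (Suc j) + B j)" by (simp add: sum.distrib)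
  also have "\<dots> = 0" by (intro sum.neutral) (simp add: cancel)
  finally show ?thesis .
qed

theorem proposition4p3:
  fixes N d :: nat and s :: "nat list" and \<eta> :: "complex list"
  assumes "1 \<le> N" and "1 \<le> d"
    and "length s = d" and "length \<eta> = d"
    and "\<forall>m\<in>set s. 1 \<le> m" and "set \<eta> \<subseteq> roots_of_unity N"
  shows "(\<exists>c. zeta_stuffle_sym N s \<eta> = [:c:]) \<and> (\<exists>c. zeta_shuffle_sym N s \<eta> = [:c:])"
proof -
  have len: "length s = length \<eta>" using assms by simp
  have hd_zip: "hd (zip s \<eta>) = (hd s, hd \<eta>)" if "s \<noteq> []" "length s = length \<eta>"
    for s :: "nat list" and \<eta> :: "complex list"
    using that by (cases s; cases \<eta>) auto
  have "pderiv (zeta_stuffle_sym N s \<eta>) = 0"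
    unfolding zeta_stuffle_sym_def
  proof (rule pderiv_symmetrized[OF len assms(5,6)])
    fix s :: "nat list" and \<eta> :: "complex list"
    assume *: "length s = length \<eta>" "zip s \<eta> \<in> y_words N"
    show "pderiv (zeta_stuffle N (1 # s) (1 # \<eta>)) = zeta_stuffle N s \<eta>"
      using pderiv_zeta_stuffle(1)[OF assms(1) *(2)] by (simp add: zeta_stuffle_def)
    show "pderiv (zeta_stuffle N s \<eta>) = 0" if "s = [] \<or> (hd s, hd \<eta>) \<noteq> (1, 1)"
    proof -
      have "zip s \<eta> = [] \<or> hd (zip s \<eta>) \<noteq> (1, 1)"
        using hd_zip[OF _ *(1)] that by (cases "s = []") auto
      then show ?thesis
        unfolding zeta_stuffle_def by (rule pderiv_zeta_stuffle(2)[OF assms(1) *(2)])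
    qed
  qed
  moreover have "pderiv (zeta_shuffle_sym N s \<eta>) = 0"
    unfolding zeta_shuffle_sym_def
  proof (rule pderiv_symmetrized[OF len assms(5,6)])
    fix s :: "nat list" and \<eta> :: "complex list"
    assume *: "length s = length \<eta>" "zip s \<eta> \<in> y_words N"
    note y = color_products_in[OF *(2)]
    show "pderiv (zeta_shuffle N (1 # s) (1 # \<eta>)) = zeta_shuffle N s \<eta>"
      using pderiv_zeta_shuffle(1)[OF assms(1) y] by (simp add: zeta_shuffle_def color_products_one_Cons)
    show "pderiv (zeta_shuffle N s \<eta>) = 0" if "s = [] \<or> (hd s, hd \<eta>) \<noteq> (1, 1)"
    proof -
      have "zip s \<eta> = [] \<or> hd (zip s \<eta>) \<noteq> (1, 1)"
        using hd_zip[OF _ *(1)] that by (cases "s = []") auto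
      then have "color_products (zip s \<eta>) = [] \<or> hd (color_products (zip s \<eta>)) \<noteq> (1, 1)"
        by (cases "zip s \<eta>") (auto simp: hd_color_products)
      then show ?thesis
        unfolding zeta_shuffle_def by (rule pderiv_zeta_shuffle(2)[OF assms(1) y])
    qed
  qed
  ultimately show ?thesis by (metis degree_eq_zeroE pderiv_eq_0_iff)
qed

end
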